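(* Let $\{\xi_i\}_{i\ge1}$ be a non-decreasing sequence of positive reals, let $N\ge1$ and $g\in\mathcal G(N,\xi)$. Then the extended matrices of transition probabilities $\overline P_N(\,\cdot\,;g)$ commute with the extended links $\overline P_N^{\downarrow}$, i.e. for all $\lambda\in\overline{\mathbb{GT}}_N$ and $\kappa\in\overline{\mathbb{GT}}_{N-1}$ $$\sum_{\mu\in\overline{\mathbb{GT}}_N}\overline P_N(\lambda\to\mu;g)\,\overline P_N^{\downarrow}(\mu\to\kappa)=\sum_{\theta\in\overline{\mathbb{GT}}_{N-1}}\overline P_N^{\downarrow}(\lambda\to\theta)\,\overline P_{N-1}(\theta\to\kappa;g).$$
   Context: $\mathbb{GT}_N=\{\lambda=(\lambda_1\ge\dots\ge\lambda_N):\lambda_i\in\mathbb Z\}$, $\mathbb{GT}_0=\{\varnothing\}$, $|\lambda|=\sum_i\lambda_i$; $s_\lambda(x_1,\dots,x_N)=\det[x_i^{\lambda_j+N-j}]_{i,j=1}^N/\prod_{i<j}(x_i-x_j)$ is the rational Schur function (a Laurent polynomial, hence defined also at points with coinciding coordinates). $\mathcal G(N,\xi)$ is the set of all finite products of functions of the following types: $x$; $x^{-1}$; $1+\beta x$, $1+\beta x^{-1}$ with $\beta>0$; $e^{\gamma x}$, $e^{\gamma x^{-1}}$ with $\gamma>0$; $(1-\alpha x)^{-1}$ with $0<\alpha<\xi_N^{-1}$; $(1-\alpha x^{-1})^{-1}$ with $0<\alpha<\xi_1$. (So $\mathcal G(N,\xi)\subset\mathcal G(k,\xi)$ for $1\le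 k\le N$.) For $g\in\mathcal G(N,\xi)$ with Laurent expansion $g(x)=\sum_{k\in\mathbb Z}c_kx^k$ converging for $\xi_1\le|x|\le\xi_N$, the stochastic matrix $P_N(\,\cdot\,;g)$ on $\mathbb{GT}_N$ is $$P_N(\lambda\to\mu;g)=\Big(\prod_{i=1}^N\frac1{g(\xi_i)}\Big)\det_{i,j=1,\dots,N}\big[c_{\mu_i-i-\lambda_j+j}\big]\frac{s_\mu(\xi_1,\dots,\xi_N)}{s_\lambda(\xi_1,\dots,\xi_N)};$$ $P_0$ is the $1\times1$ identity matrix. The link $P_N^\downarrow$ from $\mathbb{GT}_N$ to $\mathbb{GT}_{N-1}$ is the stochastic matrix $P_N^\downarrow(\lambda\to\mu)=\xi_N^{|\lambda|-|\mu|}s_\mu(\xi_1,\dots,\xi_{N-1})/s_\lambda(\xi_1,\dots,\xi_N)$ if $\lambda_1\ge\mu_1\ge\lambda_2\ge\dots\ge\mu_{N-1}\ge\lambda_N$, and $0$ otherwise. $\overline{\mathbb{GT}}_N=\{\lambda_1\ge\dots\ge\lambda_N:\lambda_i\in\mathbb Z\cup\{+\infty\}\}=\bigsqcup_{k=0}^N\mathbb{GT}_N^{(k)}$, where $\mathbb{GT}_N^{(k)}$ consists of those $\lambda$ with exactly $k$ finite coordinates (necessarily the last $k$); dropping the infinite coordinates identifies $\mathbb{GT}_N^{(k)}$ with $\mathbb{GT}_k$. Extended transition matrix: $\overline P_N(\lambda\to\mu;g)=P_k(\lambda\to\mu;g)$ if $\lambda,\mu\in\mathbb{GT}_N^{(k)}\simeq\mathbb{GT}_k$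 for some $k$, and $0$ otherwise. Extended link $\overline P_N^\downarrow$ from $\overline{\mathbb{GT}}_N$ to $\overline{\mathbb{GT}}_{N-1}$: for $\lambda\in\mathbb{GT}_N^{(N)}$, $\overline P_N^\downarrow(\lambda\to\mu)=P_N^\downarrow(\lambda\to\mu)$ if $\mu\in\mathbb{GT}_{N-1}^{(N-1)}$ and $0$ otherwise; for $\lambda\in\mathbb{GT}_N^{(k)}$ with $k<N$, $\overline P_N^\downarrow(\lambda\to\mu)=Q_N^k(\lambda\to\mu)$ if $\mu\in\mathbb{GT}_{N-1}^{(k)}$ (using $\mathbb{GT}_N^{(k)}\simeq\mathbb{GT}_{N-1}^{(k)}\simeq\mathbb{GT}_k$) and $0$ otherwise, where $Q_N^k$ is the auxiliary stochastic matrix on $\mathbb{GT}_k$ given by $P_k(\,\cdot\,;(1-\xi_N^{-1}x)^{-1})$ ($Q_N^0$ being the unique $1\times1$ stochastic matrix). *)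

theory Defs
  imports
    "HOL-Analysis.Infinite_Sum"
    "HOL-Library.Extended"
    "Jordan_Normal_Form.Determinant"
begin

text \<open>
  Indexing: sequences of variables \<open>x\<close> and of parameters \<open>\<xi>\<close> are functions on \<^typ>\<open>nat\<close> that are
  used at the indices \<open>1, 2, \<dots>\<close> only.  Signatures are lists (an element of \<open>GT\<^sub>N\<close> is a weakly
  decreasing list of length \<open>N\<close>), so the coordinate \<open>lam\<^sub>j\<close> is \<open>lam ! (j - 1)\<close>, and rows
  and columns of \<^const>\<open>mat\<close> are likewise counted from 0.
\<close>


subsection \<open>Rational Schur functions\<close>

definition laurent_polynomial :: "nat \<Rightarrow> ((nat \<Rightarrow> real) \<Rightarrow> real) \<Rightarrow> bool" where
  "laurent_polynomial N f \<longleftrightarrow>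
     (\<exists>(E :: (nat \<Rightarrow> int) set) a. finite E \<and>
        (\<forall>x. f x = (\<Sum>e\<in>E. a e * (\<Prod>i=1..N. x i powi e i))))"

text \<open>
  With \<open>i\<close> and \<open>j\<close> counted from 1, the entry of the matrix is \<open>x\<^sub>i\<close> to the power \<open>lam\<^sub>j + N - j\<close>.
\<close>
definition schur_ratio :: "nat \<Rightarrow> int list \<Rightarrow> (nat \<Rightarrow> real) \<Rightarrow> real" where
  "schur_ratio N lam x =
     Determinant.det (mat N N (\<lambda>(i, j). x (Suc i) powi (lam ! j + int N - int (Suc j)))) /
     (\<Prod>j=1..N. \<Prod>i=1..<j. x i - x j)"

text \<open>
  The Laurent polynomial that agrees with the ratio of determinants wherever that ratio makes sense.
  Its values at points with nonzero coordinates, coinciding ones included, are determined by this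
  requirement (by density and continuity); no other points are used.
\<close>
definition schur :: "nat \<Rightarrow> int list \<Rightarrow> (nat \<Rightarrow> real) \<Rightarrow> real" where
  "schur N lam = (SOME f. laurent_polynomial N f \<and>
     (\<forall>x. inj_on x {1..N} \<and> (\<forall>i\<in>{1..N}. x i \<noteq> 0) \<longrightarrow> f x = schur_ratio N lam x))"


subsection \<open>The functions \<open>g\<close> and their Laurent coefficients\<close>

text \<open>
  The functions live on the complex plane, because the Laurent expansion is taken on an annulus.
  For \<open>\<xi>\<^sub>1 = \<xi>\<^sub>N\<close> the annulus is a circle; its complex points still determine the coefficients, whereas
  its real points would not.
\<close>
definition elementary :: "nat \<Rightarrow> (nat \<Rightarrow> real) \<Rightarrow> (complex \<Rightarrow> complex) set" where
  "elementary N \<xi> =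
     {\<lambda>z. z, \<lambda>z. inverse z}
     \<union> {\<lambda>z. 1 + of_real \<beta> * z | \<beta>. \<beta> > 0}
     \<union> {\<lambda>z. 1 + of_real \<beta> * inverse z | \<beta>. \<beta> > 0}
     \<union> {\<lambda>z. exp (of_real \<gamma> * z) | \<gamma>. \<gamma> > 0}
     \<union> {\<lambda>z. exp (of_real \<gamma> * inverse z) | \<gamma>. \<gamma> > 0}
     \<union> {\<lambda>z. inverse (1 - of_real \<alpha> * z) | \<alpha>. 0 < \<alpha> \<and> \<alpha> < inverse (\<xi> N)}
     \<union> {\<lambda>z. inverse (1 - of_real \<alpha> * inverse z) | \<alpha>. 0 < \<alpha> \<and> \<alpha> < \<xi> 1}"

definition \<G> :: "nat \<Rightarrow> (nat \<Rightarrow> real) \<Rightarrow> (complex \<Rightarrow> complex) set" where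
  "\<G> N \<xi> = {\<lambda>z. \<Prod>f\<leftarrow>fs. f z | fs. set fs \<subseteq> elementary N \<xi>}"

definition laurent_coeffs :: "real \<Rightarrow> real \<Rightarrow> (complex \<Rightarrow> complex) \<Rightarrow> int \<Rightarrow> real" where
  "laurent_coeffs r R g = (THE c. \<forall>z. r \<le> norm z \<and> norm z \<le> R \<longrightarrow>
     ((\<lambda>k. of_real (c k) * z powi k) has_sum g z) UNIV)"


subsection \<open>Transition matrices and links\<close>

text \<open>
  The functions \<open>g\<close> in question take real values at real points, so \<^const>\<open>Re\<close> is only a coercion.
\<close>
definition trans_prob ::
  "(nat \<Rightarrow> real) \<Rightarrow> nat \<Rightarrow> (complex \<Rightarrow> complex) \<Rightarrow> int list \<Rightarrow> int list \<Rightarrow> real" where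
  "trans_prob \<xi> N g lam \<mu> =
     (if N = 0 then 1
      else (\<Prod>i=1..N. 1 / Re (g (of_real (\<xi> i)))) *
        Determinant.det (mat N N (\<lambda>(i, j).
          laurent_coeffs (\<xi> 1) (\<xi> N) g (\<mu> ! i - int i - lam ! j + int j))) *
        (schur N \<mu> \<xi> / schur N lam \<xi>))"

definition link :: "(nat \<Rightarrow> real) \<Rightarrow> nat \<Rightarrow> int list \<Rightarrow> int list \<Rightarrow> real" where
  "link \<xi> N lam \<mu> =
     (if \<forall>i<N-1. lam ! i \<ge> \<mu> ! i \<and> \<mu> ! i \<ge> lam ! Suc i
      then \<xi> N powi (sum_list lam - sum_list \<mu>) * schur (N - 1) \<mu> \<xi> / schur N lam \<xi>
      else 0)"

text \<open>
  The function \<open>(1 - \<xi>\<^sub>N\<inverse> x)\<inverse>\<close> is an admissible one for dimension \<open>k \<ge> 1\<close> only if \<open>\<xi>\<^sub>k < \<xi>\<^sub>N\<close>.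
  If \<open>\<xi>\<^sub>k = \<xi>\<^sub>N\<close>, it has a pole at \<open>\<xi>\<^sub>k\<close>; by the conventions for division by 0 the factor
  \<open>1 / g(\<xi>\<^sub>k)\<close> is then 0 (as is its true value \<open>1 - \<xi>\<^sub>k / \<xi>\<^sub>N\<close>), so this matrix is 0.
\<close>
definition aux_trans :: "(nat \<Rightarrow> real) \<Rightarrow> nat \<Rightarrow> nat \<Rightarrow> int list \<Rightarrow> int list \<Rightarrow> real" where
  "aux_trans \<xi> N k = trans_prob \<xi> k (\<lambda>z. inverse (1 - of_real (inverse (\<xi> N)) * z))"


subsection \<open>The extended objects\<close>

definition GT_ext :: "nat \<Rightarrow> int extended list set" where
  "GT_ext N = {lam. length lam = N \<and> sorted_wrt (\<ge>) lam \<and> Minf \<notin> set lam}"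

definition finite_part :: "int extended list \<Rightarrow> int list" where
  "finite_part lam = [n. Fin n \<leftarrow> lam]"

definition GT_part :: "nat \<Rightarrow> nat \<Rightarrow> int extended list set" where
  "GT_part N k = {lam \<in> GT_ext N. length (finite_part lam) = k}"

definition trans_ext :: "(nat \<Rightarrow> real) \<Rightarrow> nat \<Rightarrow> (complex \<Rightarrow> complex) \<Rightarrow>
    int extended list \<Rightarrow> int extended list \<Rightarrow> real" where
  "trans_ext \<xi> N g lam \<mu> =
     (let k = length (finite_part lam) in
      if lam \<in> GT_part N k \<and> \<mu> \<in> GT_part N k
      then trans_prob \<xi> k g (finite_part lam) (finite_part \<mu>) else 0)"

definition link_ext :: "(nat \<Rightarrow> real) \<Rightarrow> nat \<Rightarrow>
    int extended list \<Rightarrow> int extended list \<Rightarrow> real" where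
  "link_ext \<xi> N lam \<mu> =
     (let k = length (finite_part lam) in
      if k = N
      then (if \<mu> \<in> GT_part (N - 1) (N - 1)
            then link \<xi> N (finite_part lam) (finite_part \<mu>) else 0)
      else (if \<mu> \<in> GT_part (N - 1) k
            then aux_trans \<xi> N k (finite_part lam) (finite_part \<mu>) else 0))"

end

theory Submission
  imports Defs
begin

text \<open>
  If each row (or column) of a matrix depends on a summation variable of its own, then the sum of the
  determinants is the determinant of the sums. Everything rests on this.

  On signatures with \<open>k < N\<close> finite coordinates the claim is that \<open>P\<^sub>k(g)\<close> commutes with
  \<open>P\<^sub>k(h)\<close> for \<open>h(x) = (1 - \<xi>\<^sub>N\<inverse> x)\<inverse>\<close>. The Schur factors telescope, and by the Cauchy--Binet
  formula over all strictly decreasing integer sequences the product of the two matrices is given by the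
  determinant for the coefficients of \<open>g h\<close>, which is symmetric in \<open>g\<close> and \<open>h\<close>.

  On signatures with \<open>N\<close> finite coordinates, \<open>\<kappa>\<close> confines the coordinates of \<open>\<mu>\<close> to consecutive
  intervals, so the sum over \<open>\<mu>\<close> may be taken row by row. Adding up the rows makes the last one range over
  all of \<open>\<int>\<close>; it becomes \<open>g(\<xi>\<^sub>N) \<xi>\<^sub>N\<close> to the power \<open>lam\<^sub>j - j\<close>. Subtracting multiples of
  neighbouring columns clears this row and turns the other entries into finite sums over the intervals
  \<open>[lam\<^sub>j\<^sub>+\<^sub>1, lam\<^sub>j]\<close>, which are expanded again into the sum over \<open>\<theta>\<close>. The same column operation proves
  the branching rule of the Schur functions; it is needed because positivity of their values, also at
  coinciding \<open>\<xi>\<^sub>i\<close>, is what permits cancelling them.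
\<close>

subsection \<open>Sums of determinants\<close>

text \<open>Absolute summability of both factors carries over to the family of products, so the
  double sum may be evaluated one variable at a time.\<close>

lemma has_sum_times:
  fixes f :: "'a \<Rightarrow> 'c :: {real_normed_field, banach, uniform_topological_group_add}" and g :: "'b \<Rightarrow> 'c"
  assumes f: "(f has_sum a) A" "f abs_summable_on A"
    and g: "(g has_sum b) B" "g abs_summable_on B"
  shows "((\<lambda>(x, y). f x * g y) has_sum (a * b)) (A \<times> B)"
    and "(\<lambda>(x, y). f x * g y) abs_summable_on (A \<times> B)"
proof -
  show *: "(\<lambda>(x, y). f x * g y) abs_summable_on (A \<times> B)"
    unfolding abs_summable_on_Sigma_iff
    using f(2) g(2)
    by (auto simp: norm_mult infsum_cmult_right' abs_mult intro!: summable_on_cmult_right summable_on_cmult_left)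
  show "((\<lambda>(x, y). f x * g y) has_sum (a * b)) (A \<times> B)"
  proof -
    have sum: "((\<lambda>(x, y). f x * g y) has_sum (\<Sum>\<^sub>\<infinity>(x, y)\<in>A \<times> B. f x * g y)) (A \<times> B)"
      using abs_summable_summable[OF *] by (rule has_sum_infsum)
    have "((\<lambda>x. f x * b) has_sum (\<Sum>\<^sub>\<infinity>(x, y)\<in>A \<times> B. f x * g y)) A"
      by (rule has_sum_Sigma'[OF sum]) (auto intro: has_sum_cmult_right g)
    moreover have "((\<lambda>x. f x * b) has_sum a * b) A"
      by (intro has_sum_cmult_left f)
    ultimately show ?thesis
      using sum by (metis has_sum_unique)
  qed
qed

lemma has_sum_real_abs_summable: "(f has_sum (a :: real)) A \<Longrightarrow> f abs_summable_on A"
  by (metis summable_on_def summable_on_iff_abs_summable_on_real)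

lemma has_sum_complex_abs_summable: "(f has_sum (a :: complex)) A \<Longrightarrow> f abs_summable_on A"
  by (metis summable_on_def summable_on_iff_abs_summable_on_complex)

text \<open>Distributivity for products of series, by induction on the number of factors: the last
  entry of the list is split off. Real summable families are absolutely summable, as the product of
  two series requires.\<close>

lemma has_sum_prod_nth:
  fixes f :: "nat \<Rightarrow> 'a \<Rightarrow> real"
  assumes "\<And>i. i < n \<Longrightarrow> (f i has_sum s i) (B i)"
  shows "((\<lambda>xs. \<Prod>i<n. f i (xs ! i)) has_sum (\<Prod>i<n. s i))
    {xs. length xs = n \<and> (\<forall>i<n. xs ! i \<in> B i)}"
  using assms
proof (induction n)
  case 0
  show ?case by (rule has_sum_finiteI) auto
next
  case (Suc n)
  let ?S = "\<lambda>n. {xs. length xs = n \<and> (\<forall>i<n. xs ! i \<in> B i)}"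
  have *: "((\<lambda>xs. \<Prod>i<n. f i (xs ! i)) has_sum (\<Prod>i<n. s i)) (?S n)"
    using Suc by simp
  have **: "(f n has_sum s n) (B n)"
    using Suc by simp
  have "((\<lambda>(xs, y). (\<Prod>i<n. f i (xs ! i)) * f n y) has_sum (\<Prod>i<n. s i) * s n) (?S n \<times> B n)"
    using has_sum_times(1)[OF * has_sum_real_abs_summable[OF *] ** has_sum_real_abs_summable[OF **]] .
  also have "?this \<longleftrightarrow> ((\<lambda>xs. \<Prod>i<Suc n. f i (xs ! i)) has_sum (\<Prod>i<n. s i) * s n) (?S (Suc n))"
  proof (rule has_sum_reindex_bij_witness[where j = "\<lambda>(xs, y). xs @ [y]" and i = "\<lambda>xs. (butlast xs, last xs)"])
    fix xs assume "xs \<in> ?S (Suc n)"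
    then obtain ys y where xs: "xs = ys @ [y]" "length ys = n" "\<forall>i<Suc n. (ys @ [y]) ! i \<in> B i"
      by (cases xs rule: rev_cases) auto
    then show "(case (butlast xs, last xs) of (xs, y) \<Rightarrow> xs @ [y]) = xs"
      by simp
    have "ys ! i \<in> B i" if "i < n" for i
      using xs(2) xs(3)[rule_format, of i] that by (simp add: nth_append)
    moreover have "y \<in> B n"
      using xs(2) xs(3)[rule_format, of n] by (metis lessI nth_append_length)
    ultimately show "(butlast xs, last xs) \<in> ?S n \<times> B n"
      using xs by simp
  qed (auto simp: nth_append less_Suc_eq)
  finally show ?case by simp
qed

lemma has_sum_sum:
  fixes f :: "'i \<Rightarrow> 'a \<Rightarrow> 'b :: topological_comm_monoid_add"
  assumes "\<And>i. i \<in> I \<Longrightarrow> (f i has_sum s i) A"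
  shows "((\<lambda>x. \<Sum>i\<in>I. f i x) has_sum (\<Sum>i\<in>I. s i)) A"
  using assms by (induction I rule: infinite_finite_induct) (auto intro: has_sum_add)

lemma det_mat_leibniz:
  "det (mat n n (\<lambda>(i, j). a i j)) =
    (\<Sum>p | p permutes {0..<n}. signof p * (\<Prod>i<n. a i (p i) :: 'a :: comm_ring_1))"
proof -
  have "p i < n" if "p permutes {0..<n}" "i < n" for p i
    using that permutes_in_image[of p "{0..<n}" i] by simp
  then show ?thesis
    by (subst det_def'[of _ n]) (auto simp: atLeast0LessThan intro!: sum.cong prod.cong)
qed

text \<open>Each Leibniz term contains exactly one entry from every row, so it is a product in which
  every summation variable occurs in one factor only.\<close>

lemma has_sum_det_rows:
  fixes f :: "nat \<Rightarrow> nat \<Rightarrow> 'a \<Rightarrow> real"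
  assumes "\<And>i j. i < n \<Longrightarrow> j < n \<Longrightarrow> (f i j has_sum a i j) (B i)"
  shows "((\<lambda>xs. det (mat n n (\<lambda>(i, j). f i j (xs ! i)))) has_sum det (mat n n (\<lambda>(i, j). a i j)))
    {xs. length xs = n \<and> (\<forall>i<n. xs ! i \<in> B i)}"
proof -
  have "p i < n" if "p permutes {0..<n}" "i < n" for p i
    using that permutes_in_image[of p "{0..<n}" i] by simp
  then show ?thesis
    unfolding det_mat_leibniz
    by (intro has_sum_sum has_sum_cmult_right has_sum_prod_nth) (use assms in blast)
qed

lemma det_mat_transpose: "det (mat n n (\<lambda>(i, j). a j i)) = det (mat n n (\<lambda>(i, j). a i j))"
proof -
  have "transpose_mat (mat n n (\<lambda>(i, j). a i j)) = mat n n (\<lambda>(i, j). a j i)"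
    by auto
  then show ?thesis
    by (metis det_transpose mat_carrier)
qed

lemma has_sum_det_cols:
  fixes f :: "nat \<Rightarrow> nat \<Rightarrow> 'a \<Rightarrow> real"
  assumes "\<And>i j. i < n \<Longrightarrow> j < n \<Longrightarrow> (f i j has_sum a i j) (B j)"
  shows "((\<lambda>xs. det (mat n n (\<lambda>(i, j). f i j (xs ! j)))) has_sum det (mat n n (\<lambda>(i, j). a i j)))
    {xs. length xs = n \<and> (\<forall>j<n. xs ! j \<in> B j)}"
proof -
  have "det (mat n n (\<lambda>(i, j). f j i (xs ! i))) = det (mat n n (\<lambda>(i, j). f i j (xs ! j)))" for xs
    by (rule det_mat_transpose)
  moreover have "det (mat n n (\<lambda>(i, j). a j i)) = det (mat n n (\<lambda>(i, j). a i j))"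
    by (rule det_mat_transpose)
  moreover have "((\<lambda>xs. det (mat n n (\<lambda>(i, j). f j i (xs ! i)))) has_sum det (mat n n (\<lambda>(i, j). a j i)))
    {xs. length xs = n \<and> (\<forall>j<n. xs ! j \<in> B j)}"
    using has_sum_det_rows[of n "\<lambda>i j. f j i" B "\<lambda>i j. a j i"] assms by simp
  ultimately show ?thesis
    by presburger
qed

section \<open>Row and column operations on determinants\<close>

lemma det_scale_rows_cols:
  fixes a :: "nat \<Rightarrow> nat \<Rightarrow> 'a :: comm_ring_1"
  shows "det (mat n n (\<lambda>(i, j). r i * s j * a i j)) =
    (\<Prod>i<n. r i) * (\<Prod>j<n. s j) * det (mat n n (\<lambda>(i, j). a i j))"
proof -
  have "(\<Prod>i<n. r i * s (p i) * a i (p i)) = (\<Prod>i<n. r i) * (\<Prod>j<n. s j) * (\<Prod>i<n. a i (p i))"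
    if "p permutes {0..<n}" for p
    using prod.permute[OF that, of s] by (simp add: prod.distrib atLeast0LessThan o_def)
  then show ?thesis
    unfolding det_mat_leibniz sum_distrib_left by (intro sum.cong) (simp_all add: mult_ac)
qed

lemma det_lower_unitriangular:
  fixes l :: "nat \<Rightarrow> nat \<Rightarrow> 'a :: comm_ring_1"
  assumes "\<And>i j. i < j \<Longrightarrow> j < n \<Longrightarrow> l i j = 0" "\<And>i. i < n \<Longrightarrow> l i i = 1"
  shows "det (mat n n (\<lambda>(i, j). l i j)) = 1"
  using assms by (subst det_lower_triangular[of n]) (auto simp: prod_list_diag_prod)

lemma mat_times_mat:
  "mat n n (\<lambda>(i, j). a i j) * mat n n (\<lambda>(i, j). b i j) =
    mat n n (\<lambda>(i, j). \<Sum>k<n. a i k * b k j :: 'a :: comm_ring_1)"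
  by (rule eq_matI) (auto simp: scalar_prod_def atLeast0LessThan)

lemma det_row_differences:
  fixes a :: "nat \<Rightarrow> nat \<Rightarrow> 'a :: comm_ring_1"
  shows "det (mat n n (\<lambda>(i, j). a i j - (if i = 0 then 0 else a (i - 1) j))) = det (mat n n (\<lambda>(i, j). a i j))"
proof -
  \<comment> \<open>The bidiagonal matrix with 1 on the diagonal and -1 just below it:
    multiplication from the left subtracts from each row the preceding one.\<close>
  define l :: "nat \<Rightarrow> nat \<Rightarrow> 'a" where "l i k = (if k = i then 1 else 0) - (if Suc k = i then 1 else 0)" for i k
  have "(\<Sum>k<n. l i k * a k j) = a i j - (if i = 0 then 0 else a (i - 1) j)" if "i < n" for i j
  proof (cases i)
    case 0
    then show ?thesis using that by (simp add: l_def left_diff_distrib sum_subtractf if_distrib[of "\<lambda>x. x * _"] cong: if_cong)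
  next
    case (Suc m)
    then show ?thesis using that by (simp add: l_def left_diff_distrib sum_subtractf if_distrib[of "\<lambda>x. x * _"] cong: if_cong)
  qed
  then have "mat n n (\<lambda>(i, j). a i j - (if i = 0 then 0 else a (i - 1) j)) =
      mat n n (\<lambda>(i, j). l i j) * mat n n (\<lambda>(i, j). a i j)"
    unfolding mat_times_mat by auto
  then show ?thesis
    by (simp add: det_mult[of _ n] det_lower_unitriangular l_def)
qed

lemma det_column_differences:
  fixes a :: "nat \<Rightarrow> nat \<Rightarrow> 'a :: comm_ring_1"
  shows "det (mat n n (\<lambda>(i, j). a i j - (if Suc j < n then u j * a i (Suc j) else 0))) =
    det (mat n n (\<lambda>(i, j). a i j))"
proof -
  \<comment> \<open>The only entries off the diagonal are \<open>- u j\<close> just below it;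
    multiplication from the right subtracts \<open>u j\<close> times the next column from column
    \<open>j\<close>.\<close>
  define l where "l k j = (if k = j then 1 else 0) - (if k = Suc j then u j else 0)" for k j
  have "(\<Sum>k<n. a i k * l k j) = a i j - (if Suc j < n then u j * a i (Suc j) else 0)" if "j < n" for i j
    using that by (simp add: l_def right_diff_distrib sum_subtractf if_distrib[of "\<lambda>x. _ * x"] mult.commute cong: if_cong)
  then have "mat n n (\<lambda>(i, j). a i j - (if Suc j < n then u j * a i (Suc j) else 0)) =
      mat n n (\<lambda>(i, j). a i j) * mat n n (\<lambda>(i, j). l i j)"
    unfolding mat_times_mat by auto
  then show ?thesis
    by (simp add: det_mult[of _ n] det_lower_unitriangular l_def)
qed

text \<open>
  Subtracting multiples of the next column clears the geometric last row except for its last entry.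
\<close>
lemma det_geometric_last_row:
  fixes a :: "nat \<Rightarrow> nat \<Rightarrow> 'a :: field"
  assumes a: "\<And>j. j \<le> n \<Longrightarrow> a n j = C * q powi l j" and q: "q \<noteq> 0"
  shows "det (mat (Suc n) (Suc n) (\<lambda>(i, j). a i j)) =
    C * q powi l n * det (mat n n (\<lambda>(i, j). a i j - q powi (l j - l (Suc j)) * a i (Suc j)))"
proof -
  define b where "b i j = a i j - (if j < n then q powi (l j - l (Suc j)) * a i (Suc j) else 0)" for i j
  have last: "b n j = (if j = n then C * q powi l n else 0)" if "j \<le> n" for j
    using that q by (simp add: b_def a power_int_diff)
  have "det (mat (Suc n) (Suc n) (\<lambda>(i, j). a i j)) = det (mat (Suc n) (Suc n) (\<lambda>(i, j). b i j))"
    using det_column_differences[of "Suc n" a "\<lambda>j. q powi (l j - l (Suc j))"] by (simp add: b_def)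
  also have "\<dots> = (\<Sum>j<Suc n. b n j * cofactor (mat (Suc n) (Suc n) (\<lambda>(i, j). b i j)) n j)"
    by (subst laplace_expansion_row[of _ "Suc n" n]) auto
  also have "\<dots> = C * q powi l n * cofactor (mat (Suc n) (Suc n) (\<lambda>(i, j). b i j)) n n"
    by (simp add: last)
  also have "mat_delete (mat (Suc n) (Suc n) (\<lambda>(i, j). b i j)) n n = mat n n (\<lambda>(i, j). b i j)"
    by (auto simp: mat_delete_def)
  then have "cofactor (mat (Suc n) (Suc n) (\<lambda>(i, j). b i j)) n n = det (mat n n (\<lambda>(i, j). b i j))"
    by (simp add: cofactor_def)
  also have "mat n n (\<lambda>(i, j). b i j) = mat n n (\<lambda>(i, j). a i j - q powi (l j - l (Suc j)) * a i (Suc j))"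
    by (auto simp: b_def)
  finally show ?thesis .
qed

subsection \<open>The Cauchy--Binet formula\<close>

text \<open>Sorting recovers \<open>ms\<close> from any of its rearrangements, and since the entries
  are distinct the permutation is then determined too. This splits a sum over all lists without
  repetitions into a sum over strictly decreasing lists and permutations.\<close>

lemma distinct_lists_bij:
  "bij_betw (\<lambda>(ms, p). permute_list p ms)
    ({ms :: 'a :: linorder list. length ms = n \<and> sorted_wrt (>) ms} \<times> {p. p permutes {..<n}})
    {ys. length ys = n \<and> distinct ys}"
proof -
  have dist: "distinct ms" if "sorted_wrt (>) ms" for ms :: "'a list"
    using that by (induction ms) auto
  \<comment> \<open>\<open>sort\<close> is ascending while \<open>ms\<close> is descending, hence
    the reversal.\<close>
  have rev_sorted: "rev ms = sort (permute_list p ms)"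
    if "sorted_wrt (>) ms" "p permutes {..<length ms}" for ms :: "'a list" and p
  proof (rule properties_for_sort[symmetric])
    show "mset (rev ms) = mset (permute_list p ms)" using that by simp
    show "sorted (rev ms)"
      using that(1) by (simp add: sorted_wrt_rev) (rule sorted_wrt_mono_rel[of _ "(>)"], auto)
  qed
  have surj: "\<exists>ms p. sorted_wrt (>) ms \<and> length ms = length ys \<and> p permutes {..<length ys} \<and> permute_list p ms = ys"
    if "distinct ys" for ys :: "'a list"
  proof -
    have "mset ys = mset (rev (sort ys))" by simp
    then obtain p where "p permutes {..<length (rev (sort ys))}" "permute_list p (rev (sort ys)) = ys"
      by (rule mset_eq_permutation)
    moreover have "sorted_wrt (>) (rev (sort ys))"
      using that by (simp add: sorted_wrt_rev strict_sorted_iff)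
    ultimately show ?thesis by (metis length_rev length_sort)
  qed
  have inj_p: "p = p'"
    if "sorted_wrt (>) ms" "p permutes {..<length ms}" "p' permutes {..<length ms}"
      "permute_list p ms = permute_list p' ms" for ms :: "'a list" and p p'
  proof
    fix i
    show "p i = p' i"
    proof (cases "i < length ms")
      case True
      have "ms ! p i = ms ! p' i"
        by (simp only: permute_list_nth[OF that(2) True, symmetric] permute_list_nth[OF that(3) True, symmetric] that(4))
      moreover have "p i < length ms" "p' i < length ms"
        using True permutes_in_image[OF that(2), of i] permutes_in_image[OF that(3), of i] by simp_all
      ultimately show ?thesis
        using dist[OF that(1)] nth_eq_iff_index_eq by blast
    next
      case False
      then show ?thesis using that(2,3) by (simp add: permutes_not_in)
    qed
  qed
  have inj_ms: "ms = ms'"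
    if "sorted_wrt (>) ms" "sorted_wrt (>) ms'" "p permutes {..<length ms}" "p' permutes {..<length ms'}"
      "permute_list p ms = permute_list p' ms'" for ms ms' :: "'a list" and p p'
  proof -
    have "rev ms = rev ms'"
      using rev_sorted[OF that(1,3)] rev_sorted[OF that(2,4)] that(5) by simp
    then show ?thesis by simp
  qed
  have inj: "ms = ms' \<and> p = p'"
    if "sorted_wrt (>) ms" "sorted_wrt (>) ms'" "p permutes {..<length ms}" "p' permutes {..<length ms'}"
      "permute_list p ms = permute_list p' ms'" for ms ms' :: "'a list" and p p'
  proof -
    have ms: "ms' = ms"
      using inj_ms[OF that] ..
    show ?thesis
      using inj_p[OF that(1,3) that(4)[unfolded ms] that(5)[unfolded ms]] ms by simp
  qed
  show ?thesis
  proof (rule bij_betw_imageI)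
    show "inj_on (\<lambda>(ms, p). permute_list p ms)
      ({ms :: 'a list. length ms = n \<and> sorted_wrt (>) ms} \<times> {p. p permutes {..<n}})"
    proof (rule inj_onI, clarify)
      fix ms ms' :: "'a list" and p p'
      assume "permute_list p ms = permute_list p' ms'" "sorted_wrt (>) ms" "sorted_wrt (>) ms'"
        "n = length ms" "length ms' = length ms" "p permutes {..<length ms}" "p' permutes {..<length ms}"
      then show "ms = ms' \<and> p = p'"
        by (intro inj) simp_all
    qed
    show "(\<lambda>(ms, p). permute_list p ms) `
      ({ms :: 'a list. length ms = n \<and> sorted_wrt (>) ms} \<times> {p. p permutes {..<n}}) =
      {ys. length ys = n \<and> distinct ys}" (is "?F ` ?M = ?D")
    proof (intro subset_antisym subsetI)
      fix ys assume "ys \<in> ?F ` ?M"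
      then show "ys \<in> ?D"
        using dist by auto
    next
      fix ys assume "ys \<in> ?D"
      then obtain ms p where "sorted_wrt (>) ms" "length ms = n" "p permutes {..<n}" "ys = permute_list p ms"
        using surj[of ys] by auto
      then show "ys \<in> ?F ` ?M"
        by (intro image_eqI[of _ _ "(ms, p)"]) auto
    qed
  qed
qed

text \<open>Row-by-row expansion gives a sum over all lists \<open>ys\<close>; a repeated entry
  makes two rows of the \<open>b\<close> determinant equal, so only lists with distinct entries
  count. For these, permuting the rows of the \<open>b\<close> determinant produces a sign, and the
  sum over the permutations of a fixed \<open>ms\<close> reassembles the \<open>a\<close>
  determinant.\<close>

lemma cauchy_binet_has_sum:
  fixes a b :: "nat \<Rightarrow> 'a :: linorder \<Rightarrow> real"
  assumes "\<And>i j. i < n \<Longrightarrow> j < n \<Longrightarrow> ((\<lambda>y. a i y * b j y) has_sum e i j) UNIV"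
  shows "((\<lambda>ms. det (mat n n (\<lambda>(i, j). a i (ms ! j))) * det (mat n n (\<lambda>(i, j). b j (ms ! i))))
    has_sum det (mat n n (\<lambda>(i, j). e i j))) {ms. length ms = n \<and> sorted_wrt (>) ms}"
proof -
  let ?d = "\<lambda>ys. (\<Prod>i<n. a i (ys ! i)) * det (mat n n (\<lambda>(i, j). b j (ys ! i)))"
  have scale: "det (mat n n (\<lambda>(i, j). a i (ys ! i) * b j (ys ! i))) = ?d ys" for ys
    using det_scale_rows_cols[of n "\<lambda>i. a i (ys ! i)" "\<lambda>_. 1" "\<lambda>i j. b j (ys ! i)"] by simp
  have vanish: "det (mat n n (\<lambda>(i, j). b j (ys ! i))) = 0" if ys: "length ys = n" "\<not> distinct ys" for ys
  proof -
    obtain i j where "i < n" "j < n" "i \<noteq> j" "ys ! i = ys ! j"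
      using ys unfolding distinct_conv_nth by blast
    then show ?thesis
      by (intro det_identical_rows[of _ n i j]) auto
  qed
  have "(?d has_sum det (mat n n (\<lambda>(i, j). e i j))) {ys. length ys = n}"
    using has_sum_det_rows[of n "\<lambda>i j y. a i y * b j y" "\<lambda>_. UNIV" e, OF assms] by (simp add: scale)
  also have "?this \<longleftrightarrow> (?d has_sum det (mat n n (\<lambda>(i, j). e i j))) {ys. length ys = n \<and> distinct ys}"
    by (rule has_sum_cong_neutral) (auto simp: vanish)
  also have "\<dots> \<longleftrightarrow> ((\<lambda>(ms, p). ?d (permute_list p ms)) has_sum det (mat n n (\<lambda>(i, j). e i j)))
      ({ms. length ms = n \<and> sorted_wrt (>) ms} \<times> {p. p permutes {..<n}})"
    by (subst has_sum_reindex_bij_betw[OF distinct_lists_bij, symmetric]) (simp add: case_prod_unfold)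
  finally have *: "\<dots>" .
  show ?thesis
  proof (rule has_sum_Sigma'[OF *], clarsimp)
    fix ms :: "'a list" assume ms: "n = length ms"
    have "?d (permute_list p ms) = signof p * (\<Prod>i<n. a i (ms ! p i)) * det (mat n n (\<lambda>(i, j). b j (ms ! i)))"
      if p: "p permutes {..<n}" for p
    proof -
      have "det (mat n n (\<lambda>(i, j). b j (permute_list p ms ! i))) =
        det (mat n n (\<lambda>(i, j). mat n n (\<lambda>(i, j). b j (ms ! i)) $$ (p i, j)))"
        using p ms permutes_in_image[OF p] by (intro arg_cong[of _ _ det] eq_matI) (auto simp: permute_list_nth)
      also have "\<dots> = signof p * det (mat n n (\<lambda>(i, j). b j (ms ! i)))"
        using p by (intro det_permute_rows) (auto simp: atLeast0LessThan)
      finally show ?thesis using p ms by (simp add: permute_list_nth)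
    qed
    then have "(\<Sum>p | p permutes {..<n}. ?d (permute_list p ms)) =
      (\<Sum>p | p permutes {..<n}. signof p * (\<Prod>i<n. a i (ms ! p i))) * det (mat n n (\<lambda>(i, j). b j (ms ! i)))"
      by (simp add: sum_distrib_right)
    also have "(\<Sum>p | p permutes {..<n}. signof p * (\<Prod>i<n. a i (ms ! p i))) = det (mat n n (\<lambda>(i, j). a i (ms ! j)))"
      by (simp add: det_mat_leibniz atLeast0LessThan)
    finally show "((\<lambda>p. (\<Prod>i<length ms. a i (permute_list p ms ! i)) *
        det (mat (length ms) (length ms) (\<lambda>(i, j). b j (permute_list p ms ! i)))) has_sum
      det (mat (length ms) (length ms) (\<lambda>(i, j). a i (ms ! j))) * det (mat (length ms) (length ms) (\<lambda>(i, j). b j (ms ! i))))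
      {p. p permutes {..<length ms}}"
      unfolding ms by (intro has_sum_finiteI) (auto intro: finite_permutations)
  qed
qed

subsection \<open>Laurent expansions\<close>

text \<open>The condition under the definite description in \<open>laurent_coeffs\<close>, named so
  that existence and uniqueness of the coefficients can be treated separately.\<close>

definition laurent_expansion :: "real \<Rightarrow> real \<Rightarrow> (complex \<Rightarrow> complex) \<Rightarrow> (int \<Rightarrow> real) \<Rightarrow> bool" where
  "laurent_expansion r R g c \<longleftrightarrow> (\<forall>z. r \<le> norm z \<and> norm z \<le> R \<longrightarrow>
     ((\<lambda>k. of_real (c k) * z powi k) has_sum g z) UNIV)"

text \<open>The \<open>k\<close>-th powers of the roots are the successive powers of one number
  \<open>w\<close> with \<open>w ^ M = 1\<close>; this geometric sum vanishes unless
  \<open>w = 1\<close>.\<close>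

lemma sum_roots_of_unity_powi:
  fixes k :: int and M :: nat
  assumes M: "M > 0"
  shows "(\<Sum>j<M. cis (2 * pi * real j / real M) powi k) = (if int M dvd k then of_nat M else 0)"
proof -
  define w where "w = cis (2 * pi * of_int k / real M)"
  have *: "cis (2 * pi * real j / real M) powi k = w ^ j" for j
    by (simp add: w_def cis_power_int DeMoivre field_simps)
  have "w ^ M = 1"
    using M by (simp add: w_def DeMoivre cis_multiple_2pi)
  moreover have "w = 1 \<longleftrightarrow> int M dvd k"
  proof
    assume "w = 1"
    then have "cos (2 * pi * of_int k / real M) = 1"
      by (simp add: w_def complex_eq_iff)
    then obtain m :: int where "2 * pi * of_int k / real M = of_int m * 2 * pi"
      by (auto simp: cos_one_2pi_int)
    then have "real_of_int k = real_of_int (m * int M)"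
      using M by (simp add: field_simps)
    then have "k = m * int M" by (simp only: of_int_eq_iff)
    then show "int M dvd k" by simp
  next
    assume "int M dvd k"
    then obtain m where "k = int M * m" by (elim dvdE)
    then show "w = 1"
      using M cis_multiple_2pi[of "of_int m"] by (simp add: w_def mult_ac)
  qed
  ultimately show ?thesis
    by (simp add: * sum_gp_strict)
qed

text \<open>
  Averaging over the \<open>M\<close>-th roots of unity keeps the coefficients with index divisible by \<open>M\<close>; for
  large \<open>M\<close> all of these except the one at 0 belong to the tail of the series.
\<close>
lemma has_sum_zero_on_circle_imp_coeff_0:
  fixes a :: "int \<Rightarrow> complex"
  assumes sum0: "\<And>w. norm w = 1 \<Longrightarrow> ((\<lambda>k. a k * w powi k) has_sum 0) UNIV"
  shows "a 0 = 0"
proof -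
  have "((\<lambda>k. a k) has_sum 0) UNIV"
    using sum0[of 1] by simp
  then have abs: "a abs_summable_on UNIV"
    by (rule has_sum_complex_abs_summable)
  have "norm (a 0) \<le> e" if e: "e > 0" for e
  proof -
    obtain F where F: "finite F" "dist (\<Sum>k\<in>F. norm (a k)) (\<Sum>\<^sub>\<infinity>k. norm (a k)) \<le> e"
      using has_sum_finite_approximation[OF has_sum_infsum[OF abs] e] by auto
    \<comment> \<open>The sum dominates each \<open>\<bar>k\<bar>\<close> with
      \<open>k \<in> F\<close>, so 0 is the only index in \<open>F\<close> that \<open>M\<close>
      divides.\<close>
    define M where "M = Suc (\<Sum>k\<in>F. nat \<bar>k\<bar>)"
    have M: "M > 0" by (simp add: M_def)
    have not_dvd: "\<not> int M dvd k" if "k \<in> F" "k \<noteq> 0" for k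
    proof
      assume "int M dvd k"
      then have "M \<le> nat \<bar>k\<bar>"
        using dvd_imp_le_int[of k "int M"] \<open>k \<noteq> 0\<close> by simp
      moreover have "nat \<bar>k\<bar> \<le> (\<Sum>k\<in>F. nat \<bar>k\<bar>)"
        using F(1) \<open>k \<in> F\<close> by (intro member_le_sum) auto
      ultimately show False by (simp add: M_def)
    qed
    let ?w = "\<lambda>j. cis (2 * pi * real j / real M)"
    have "((\<lambda>k. \<Sum>j<M. a k * ?w j powi k) has_sum (\<Sum>j<M. 0)) UNIV"
      by (intro has_sum_sum sum0) simp
    also have "(\<lambda>k. \<Sum>j<M. a k * ?w j powi k) = (\<lambda>k. if int M dvd k then of_nat M * a k else 0)"
      by (simp add: sum_distrib_left[symmetric] sum_roots_of_unity_powi[OF M] fun_eq_iff)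
    finally have "((\<lambda>k. (if int M dvd k then of_nat M * a k else 0) * inverse (of_nat M)) has_sum
        (\<Sum>j<M. 0) * inverse (of_nat M)) UNIV"
      by (rule has_sum_cmult_left)
    also have "(\<lambda>k. (if int M dvd k then of_nat M * a k else 0) * inverse (of_nat M)) =
        (\<lambda>k. if int M dvd k then a k else 0)"
      using M by (auto simp: field_simps)
    finally have "((\<lambda>k. if int M dvd k then a k else 0) has_sum 0) UNIV" by simp
    \<comment> \<open>With index 0 taken out, the averaged series has sum \<open>- a 0\<close>; it
      is supported outside \<open>F\<close>, where the norms add up to at most
      \<open>e\<close>.\<close>
    then have "((\<lambda>k. if int M dvd k then a k else 0) has_sum 0 - a 0) (UNIV - {0})"
      using has_sum_Diff[of "\<lambda>k. if int M dvd k then a k else 0" UNIV 0 "{0}" "a 0"]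
        has_sum_finite[of "{0}" "\<lambda>k. if int M dvd k then a k else 0"] by simp
    then have "((\<lambda>k. if int M dvd k then a k else 0) has_sum - a 0) (- F - {0})"
      by (subst has_sum_cong_neutral[where T = "UNIV - {0}" and g = "\<lambda>k. if int M dvd k then a k else 0"])
        (auto simp: not_dvd)
    moreover have abs': "(\<lambda>k. norm (a k)) summable_on (- F)"
      using abs by (rule summable_on_subset_banach) auto
    ultimately have "norm (- a 0) \<le> (\<Sum>\<^sub>\<infinity>k\<in>-F - {0}. norm (if int M dvd k then a k else 0))"
      by (metis has_sum_complex_abs_summable infsumI norm_infsum_bound)
    also have "\<dots> \<le> (\<Sum>\<^sub>\<infinity>k\<in>-F. norm (a k))"
    proof (rule infsum_mono_neutral)
      show "(\<lambda>k. norm (if int M dvd k then a k else 0)) summable_on - F - {0}"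
        using \<open>(_ has_sum - a 0) (- F - {0})\<close> by (rule has_sum_complex_abs_summable)
    qed (use abs' in auto)
    also have "(\<Sum>\<^sub>\<infinity>k\<in>-F. norm (a k)) = (\<Sum>\<^sub>\<infinity>k. norm (a k)) - (\<Sum>k\<in>F. norm (a k))"
      using F(1) abs by (simp add: Compl_eq_Diff_UNIV infsum_Diff)
    also have "\<dots> \<le> e"
      using F(2) by (simp add: dist_real_def)
    finally show ?thesis by simp
  qed
  then have "norm (a 0) \<le> 0"
    by (rule field_le_epsilon) simp
  then show ?thesis by simp
qed

text \<open>The circle of radius \<open>r\<close> alone suffices, so the annulus may be degenerate.
  There the difference of the two expansions sums to 0; dividing by the \<open>n\<close>-th power of
  the unit variable moves the coefficient in question to index 0, and powers of \<open>r\<close>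
  rescale to the unit circle.\<close>

lemma laurent_expansion_unique:
  assumes "laurent_expansion r R g c" "laurent_expansion r R g d" "0 < r" "r \<le> R"
  shows "c = d"
proof
  fix n
  define a where "a k = complex_of_real ((c (k + n) - d (k + n)) * r powi (k + n))" for k
  have "((\<lambda>k. a k * w powi k) has_sum 0) UNIV" if "norm w = 1" for w
  proof -
    have w: "w \<noteq> 0" using that by auto
    have "((\<lambda>k. of_real (c k) * (of_real r * w) powi k - of_real (d k) * (of_real r * w) powi k) has_sum
        g (of_real r * w) - g (of_real r * w)) UNIV"
      unfolding diff_conv_add_uminus using assms that
      by (intro has_sum_add) (auto simp: laurent_expansion_def norm_mult has_sum_uminus)
    then have "((\<lambda>k. (of_real (c (k + n)) * (of_real r * w) powi (k + n)
        - of_real (d (k + n)) * (of_real r * w) powi (k + n)) * w powi (-n)) has_sum 0 * w powi (-n)) UNIV"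
      by (intro has_sum_cmult_left, subst (asm) has_sum_reindex_bij_betw[of "\<lambda>k. k + n" UNIV, symmetric])
        (auto intro!: bij_betwI[where g = "\<lambda>k. k - n"])
    moreover have "(of_real (c (k + n)) * (of_real r * w) powi (k + n)
        - of_real (d (k + n)) * (of_real r * w) powi (k + n)) * w powi (-n) = a k * w powi k" for k
      using w assms(3) by (simp add: a_def power_int_mult_distrib power_int_add power_int_minus field_simps)
    ultimately show ?thesis by simp
  qed
  then have "a 0 = 0"
    by (rule has_sum_zero_on_circle_imp_coeff_0)
  then show "c n = d n"
    using assms(3) by (simp add: a_def)
qed

text \<open>Any expansion at hand thus replaces the definite description. On the smaller annuli that
  belong to \<open>n \<le> N\<close> this makes one and the same coefficient sequence serve for all
  sizes.\<close>

lemma laurent_coeffs_eq: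
  assumes "laurent_expansion r R g c" "0 < r" "r \<le> R"
  shows "laurent_coeffs r R g = c"
  unfolding laurent_coeffs_def laurent_expansion_def[symmetric]
  using assms by (intro the_equality) (auto intro: laurent_expansion_unique)

lemma laurent_expansion_subset:
  "laurent_expansion r R g c \<Longrightarrow> r \<le> r' \<Longrightarrow> R' \<le> R \<Longrightarrow> laurent_expansion r' R' g c"
  by (auto simp: laurent_expansion_def)

section \<open>Existence of expansions, products of expansions, and the class
  \<open>\<G>\<close>\<close>

lemma laurent_expansion_finite:
  assumes "finite A" "\<And>k. k \<notin> A \<Longrightarrow> c k = 0" "\<And>z. r \<le> norm z \<Longrightarrow> g z = (\<Sum>k\<in>A. of_real (c k) * z powi k)"
  shows "laurent_expansion r R g c"
  unfolding laurent_expansion_def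
  by (auto intro!: has_sum_finite_neutralI[where B = A] simp: assms)

lemma laurent_expansion_power_series:
  assumes "\<And>z. r \<le> norm z \<Longrightarrow> norm z \<le> R \<Longrightarrow> (\<lambda>n. of_real (a n) * z ^ n) sums g z \<and>
    summable (\<lambda>n. norm (of_real (a n) * z ^ n))"
  shows "laurent_expansion r R g (\<lambda>k. if k \<ge> 0 then a (nat k) else 0)"
  unfolding laurent_expansion_def
proof (intro allI impI)
  fix z :: complex assume z: "r \<le> norm z \<and> norm z \<le> R"
  have "((\<lambda>n. of_real (a n) * z ^ n) has_sum g z) UNIV"
    using assms z by (intro norm_summable_imp_has_sum) auto
  also have "?this \<longleftrightarrow> ((\<lambda>k. of_real (a (nat k)) * z powi k) has_sum g z) {0..}"
    by (rule has_sum_reindex_bij_witness[where j = int and i = nat]) auto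
  also have "\<dots> \<longleftrightarrow> ((\<lambda>k. of_real (if k \<ge> 0 then a (nat k) else 0) * z powi k) has_sum g z) UNIV"
    by (rule has_sum_cong_neutral) auto
  finally show "((\<lambda>k. of_real (if k \<ge> 0 then a (nat k) else 0) * z powi k) has_sum g z) UNIV" .
qed

lemma laurent_expansion_inverse_arg:
  assumes "laurent_expansion (inverse R) (inverse r) g c" "0 < r"
  shows "laurent_expansion r R (\<lambda>z. g (inverse z)) (\<lambda>k. c (-k))"
  unfolding laurent_expansion_def
proof (intro allI impI)
  fix z :: complex assume z: "r \<le> norm z \<and> norm z \<le> R"
  then have "inverse R \<le> norm (inverse z)" "norm (inverse z) \<le> inverse r"
    unfolding norm_inverse using assms(2) by (intro le_imp_inverse_le; linarith)+
  then have "((\<lambda>k. of_real (c k) * inverse z powi k) has_sum g (inverse z)) UNIV"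
    using assms(1) by (simp add: laurent_expansion_def)
  also have "?this \<longleftrightarrow> ((\<lambda>k. of_real (c (-k)) * z powi k) has_sum g (inverse z)) UNIV"
    by (rule has_sum_reindex_bij_witness[where j = uminus and i = uminus])
      (auto simp: power_int_inverse power_int_minus)
  finally show "((\<lambda>k. of_real (c (-k)) * z powi k) has_sum g (inverse z)) UNIV" .
qed

text \<open>The product of the two series, regrouped by the total exponent \<open>n = m + l\<close>.
  It is kept as a double series because both the summability of the convolutions and the expansion
  of the product are read off from it.\<close>

lemma laurent_double_series:
  assumes f: "laurent_expansion r R f c" and g: "laurent_expansion r R g d" and r: "0 < r"
    and z: "r \<le> norm z \<and> norm z \<le> R"
  shows "((\<lambda>(n, m). of_real (c m * d (n - m)) * z powi n) has_sum f z * g z) (UNIV \<times> UNIV)"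
proof -
  have z0: "z \<noteq> 0" using r z by auto
  have f': "((\<lambda>k. of_real (c k) * z powi k) has_sum f z) UNIV"
    and g': "((\<lambda>k. of_real (d k) * z powi k) has_sum g z) UNIV"
    using f g z by (auto simp: laurent_expansion_def)
  have "((\<lambda>(m, l). (of_real (c m) * z powi m) * (of_real (d l) * z powi l)) has_sum f z * g z) (UNIV \<times> UNIV)"
    by (rule has_sum_times(1)[OF f' has_sum_complex_abs_summable[OF f'] g' has_sum_complex_abs_summable[OF g']])
  also have "?this \<longleftrightarrow> ?thesis"
    by (rule has_sum_reindex_bij_witness[where j = "\<lambda>(m, l). (m + l, m)" and i = "\<lambda>(n, m). (m, n - m)"])
      (auto simp: power_int_add z0)
  finally show ?thesis .
qed

text \<open>A section of a summable double family is summable; the point \<open>z = r\<close>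
  serves, since its power is a nonzero constant on the section.\<close>

lemma laurent_convolution_summable:
  assumes "laurent_expansion r R f c" "laurent_expansion r R g d" "0 < r" "r \<le> R"
  shows "(\<lambda>m. c m * d (n - m)) summable_on UNIV"
proof -
  have "(\<lambda>(n, m). of_real (c m * d (n - m)) * complex_of_real r powi n) summable_on (UNIV \<times> UNIV)"
    using laurent_double_series[OF assms(1-3), of "of_real r"] assms(3,4) by (auto simp: summable_on_def)
  then have "(\<lambda>m. of_real (c m * d (n - m)) * complex_of_real r powi n) summable_on UNIV"
    using summable_on_SigmaD1[of "\<lambda>n m. complex_of_real (c m * d (n - m)) * of_real r powi n" UNIV "\<lambda>_. UNIV" n]
    by simp
  then have "(\<lambda>m. complex_of_real (c m * d (n - m))) summable_on UNIV"
    using assms(3) by (simp add: summable_on_cmult_left')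
  then show ?thesis
    using has_sum_bounded_linear[OF bounded_linear_Re] by (fastforce simp: summable_on_def)
qed

lemma laurent_expansion_mult:
  assumes f: "laurent_expansion r R f c" and g: "laurent_expansion r R g d" and r: "0 < r"
  shows "laurent_expansion r R (\<lambda>z. f z * g z) (\<lambda>n. \<Sum>\<^sub>\<infinity>m. c m * d (n - m))"
  unfolding laurent_expansion_def
proof (intro allI impI)
  fix z :: complex assume z: "r \<le> norm z \<and> norm z \<le> R"
  show "((\<lambda>n. of_real (\<Sum>\<^sub>\<infinity>m. c m * d (n - m)) * z powi n) has_sum f z * g z) UNIV"
  proof (rule has_sum_Sigma'[OF laurent_double_series[OF f g r z]], clarsimp)
    fix n
    have "(\<lambda>m. c m * d (n - m)) summable_on UNIV"
      using f g r order.trans[OF conjunct1[OF z] conjunct2[OF z]] by (rule laurent_convolution_summable)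
    then have "((\<lambda>m. of_real (c m * d (n - m)) :: complex) has_sum of_real (\<Sum>\<^sub>\<infinity>m. c m * d (n - m))) UNIV"
      by (simp only: has_sum_of_real_iff has_sum_infsum)
    then show "((\<lambda>m. of_real (c m) * of_real (d (n - m)) * z powi n) has_sum
        of_real (\<Sum>\<^sub>\<infinity>m. c m * d (n - m)) * z powi n) UNIV"
      by (auto intro: has_sum_cmult_left)
  qed
qed

text \<open>The functions of \<open>z\<close> are polynomials or power series; those of
  \<open>inverse z\<close> follow by inverting the annulus. The bounds on \<open>\<alpha>\<close>
  keep the geometric ratio below 1 in norm on the whole closed annulus.\<close>

lemma laurent_expansion_elementary:
  assumes "f \<in> elementary k \<xi>" "0 < \<xi> 1" "\<xi> 1 \<le> \<xi> k"
  shows "\<exists>c. laurent_expansion (\<xi> 1) (\<xi> k) f c"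
proof -
  have expo: "\<exists>c. laurent_expansion r R (\<lambda>z. exp (of_real \<gamma> * z)) c" for \<gamma> r R
  proof (rule exI, rule laurent_expansion_power_series, rule conjI)
    fix z :: complex
    have eq: "of_real (\<gamma> ^ n / fact n) * z ^ n = (of_real \<gamma> * z) ^ n /\<^sub>R fact n" for n
      by (simp add: power_mult_distrib scaleR_conv_of_real field_simps)
    show "(\<lambda>n. of_real (\<gamma> ^ n / fact n) * z ^ n) sums exp (of_real \<gamma> * z)"
      unfolding eq by (rule exp_converges)
    show "summable (\<lambda>n. norm (of_real (\<gamma> ^ n / fact n) * z ^ n))"
      using summable_norm_exp[of "of_real \<gamma> * z"] by (simp only: eq)
  qed
  have geom: "\<exists>c. laurent_expansion r R (\<lambda>z. inverse (1 - of_real \<alpha> * z)) c"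
    if "0 < \<alpha>" "\<alpha> * R < 1" for \<alpha> r R
  proof (rule exI, rule laurent_expansion_power_series, rule conjI)
    fix z :: complex assume "norm z \<le> R"
    then have "\<alpha> * norm z \<le> \<alpha> * R"
      using that by simp
    also have "\<dots> < 1" by (fact that)
    finally have lt: "norm (of_real \<alpha> * z) < 1"
      using that by (simp add: norm_mult)
    have eq: "of_real (\<alpha> ^ n) * z ^ n = (of_real \<alpha> * z) ^ n" for n
      by (simp add: power_mult_distrib)
    show "(\<lambda>n. of_real (\<alpha> ^ n) * z ^ n) sums inverse (1 - of_real \<alpha> * z)"
      unfolding eq using geometric_sums[OF lt] by (simp add: inverse_eq_divide)
    show "summable (\<lambda>n. norm (of_real (\<alpha> ^ n) * z ^ n))"
      unfolding eq using lt by (simp add: norm_power summable_geometric)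
  qed
  \<comment> \<open>\<open>a = 0\<close> with slope 1 is the function \<open>z\<close> itself,
    \<open>a = 1\<close> gives the linear factors.\<close>
  have lin: "\<exists>c. laurent_expansion r R (\<lambda>z. a + of_real \<beta> * z) c" if "a = 0 \<or> a = 1" for a \<beta> r R
    using that
    by (intro exI[of _ "\<lambda>k. if k = 0 then Re a else if k = 1 then \<beta> else 0"] laurent_expansion_finite[where A = "{0, 1}"])
      auto
  have inv: "\<exists>c. laurent_expansion (\<xi> 1) (\<xi> k) (\<lambda>z. h (inverse z)) c"
    if "\<exists>c. laurent_expansion (inverse (\<xi> k)) (inverse (\<xi> 1)) h c" for h
    using that laurent_expansion_inverse_arg assms(2) by blast
  have gt: "\<alpha> * \<xi> k < 1" if "0 < \<alpha>" "\<alpha> < inverse (\<xi> k)" for \<alpha>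
    using that assms(2,3) by (simp add: field_simps)
  have gt': "\<alpha> * inverse (\<xi> 1) < 1" if "0 < \<alpha>" "\<alpha> < \<xi> 1" for \<alpha>
    using that by (simp add: field_simps)
  have id: "\<exists>c. laurent_expansion r R (\<lambda>z. z) c" for r R
    using lin[of 0 r R 1] by simp
  have one: "\<exists>c. laurent_expansion r R (\<lambda>z. 1 + of_real \<beta> * z) c" for \<beta> r R
    by (rule lin) simp
  from assms(1) consider "f = (\<lambda>z. z)" | "f = inverse" | \<beta> where "f = (\<lambda>z. 1 + of_real \<beta> * z)"
    | \<beta> where "f = (\<lambda>z. 1 + of_real \<beta> * inverse z)" | \<gamma> where "f = (\<lambda>z. exp (of_real \<gamma> * z))"
    | \<gamma> where "f = (\<lambda>z. exp (of_real \<gamma> * inverse z))"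
    | \<alpha> where "f = (\<lambda>z. inverse (1 - of_real \<alpha> * z))" "0 < \<alpha>" "\<alpha> < inverse (\<xi> k)"
    | \<alpha> where "f = (\<lambda>z. inverse (1 - of_real \<alpha> * inverse z))" "0 < \<alpha>" "\<alpha> < \<xi> 1"
    unfolding elementary_def by auto
  then show ?thesis
  proof cases
    case 1 then show ?thesis by (simp add: id)
  next
    case 2 then show ?thesis using inv[OF id] by simp
  next
    case 3 then show ?thesis by (simp add: one)
  next
    case 4 then show ?thesis using inv[OF one] by simp
  next
    case 5 then show ?thesis by (simp add: expo)
  next
    case 6 then show ?thesis using inv[OF expo] by simp
  next
    case 7 then show ?thesis by (simp add: geom gt)
  next
    case 8 then show ?thesis using inv[OF geom] gt' by simp
  qed
qed

lemma laurent_expansion_prod_list: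
  assumes "set fs \<subseteq> elementary k \<xi>" "0 < \<xi> 1" "\<xi> 1 \<le> \<xi> k"
  shows "\<exists>c. laurent_expansion (\<xi> 1) (\<xi> k) (\<lambda>z. \<Prod>f\<leftarrow>fs. f z) c"
  using assms(1)
proof (induction fs)
  case Nil
  show ?case
    by (intro exI[of _ "\<lambda>k. if k = 0 then 1 else 0"] laurent_expansion_finite[where A = "{0}"]) auto
next
  case (Cons f fs)
  then show ?case
    using laurent_expansion_elementary[of f k \<xi>] laurent_expansion_mult assms(2,3) by fastforce
qed

text \<open>Needed to cancel the value of \<open>g\<close> at \<open>\<xi> N\<close>. As
  \<open>inverse 0 = 0\<close>, nonvanishing of a geometric factor means that the point is not a
  pole, which the bounds on \<open>\<alpha>\<close> ensure.\<close>

lemma elementary_real_point_nonzero: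
  assumes "f \<in> elementary k \<xi>" "0 < \<xi> 1" "\<xi> 1 \<le> x" "x \<le> \<xi> k"
  shows "f (of_real x) \<noteq> 0"
proof -
  have x: "x > 0" using assms by simp
  have lin: "1 + complex_of_real b * of_real y \<noteq> 0" "1 - complex_of_real b * of_real y \<noteq> 0 \<longleftrightarrow> b * y \<noteq> 1"
    if "b > 0" "y > 0" for b y
  proof -
    have "1 + b * y \<noteq> 0" using mult_pos_pos[OF that] by linarith
    then show "1 + complex_of_real b * of_real y \<noteq> 0"
      by (simp add: complex_eq_iff)
    show "1 - complex_of_real b * of_real y \<noteq> 0 \<longleftrightarrow> b * y \<noteq> 1"
      by (simp add: complex_eq_iff)
  qed
  have 1: "\<alpha> * x \<noteq> 1" if "0 < \<alpha>" "\<alpha> < inverse (\<xi> k)" for \<alpha>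
  proof -
    have "\<alpha> * x \<le> \<alpha> * \<xi> k" using that assms by simp
    moreover have "\<alpha> * \<xi> k < 1" using that assms by (simp add: field_simps)
    ultimately show ?thesis by simp
  qed
  have 2: "\<alpha> * inverse x \<noteq> 1" if "0 < \<alpha>" "\<alpha> < \<xi> 1" for \<alpha>
    using that assms x by (auto simp: field_simps)
  show ?thesis
    using assms(1) unfolding elementary_def
    using lin[OF _ x] lin[of _ "inverse x"] 1 2 x
    by (elim UnE insertE emptyE CollectE exE conjE; hypsubst) auto
qed

subsection \<open>Schur functions\<close>

text \<open>Written as a product of intervals, one for each coordinate, which is the shape that sums
  of determinants by columns require; that its elements decrease is then a consequence.\<close>

definition interlacing :: "int list \<Rightarrow> int list set" where
  "interlacing lam = {\<mu>. length \<mu> = length lam - 1 \<and> (\<forall>i<length lam - 1. \<mu> ! i \<in> {lam ! Suc i..lam ! i})}"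

lemma finite_interlacing: "finite (interlacing lam)"
proof (rule finite_subset)
  let ?S = "\<Union>i<length lam - 1. {lam ! Suc i..lam ! i}"
  show "interlacing lam \<subseteq> {\<mu>. set \<mu> \<subseteq> ?S \<and> length \<mu> = length lam - 1}"
    by (fastforce simp: interlacing_def in_set_conv_nth)
  show "finite {\<mu>. set \<mu> \<subseteq> ?S \<and> length \<mu> = length lam - 1}"
    by (rule finite_lists_length_eq) simp
qed

lemma sorted_wrt_interlacing:
  assumes "\<mu> \<in> interlacing lam"
  shows "sorted_wrt (\<ge>) \<mu>"
proof -
  have "\<mu> ! Suc i \<le> \<mu> ! i" if "Suc i < length \<mu>" for i
  proof -
    have "\<mu> ! Suc i \<le> lam ! Suc i" "lam ! Suc i \<le> \<mu> ! i"
      using assms that by (auto simp: interlacing_def)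
    then show ?thesis by simp
  qed
  then show ?thesis
    by (subst sorted_wrt_iff_nth_Suc_transp) (auto intro: transpI)
qed

section \<open>The branching rule, and Schur functions as positive Laurent polynomials\<close>

lemma powi_sum:
  fixes q :: "'a :: field"
  assumes "q \<noteq> 0"
  shows "(\<Prod>j\<in>A. q powi e j) = q powi (\<Sum>j\<in>A. e j)"
  using assms by (induction A rule: infinite_finite_induct) (auto simp: power_int_add)

text \<open>The factorisation of \<open>x ^ d - q ^ d\<close> with \<open>d = a + 1 - b\<close>,
  carried over to integer exponents. The left side is what the column operation leaves of an entry
  of the Schur numerator.\<close>

lemma powi_geometric_sum:
  fixes x q :: "'a :: field"
  assumes "x \<noteq> 0" "q \<noteq> 0" "b \<le> a"
  shows "x powi (a + 1 + s) - q powi (a + 1 - b) * x powi (b + s) =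
    (x - q) * (\<Sum>t\<in>{b..a}. x powi (t + s) * q powi (a - t))"
proof -
  define d where "d = nat (a + 1 - b)"
  have d: "int d = a + 1 - b" using assms(3) by (simp add: d_def)
  have "(\<Sum>t\<in>{b..a}. x powi (t + s) * q powi (a - t)) = (\<Sum>i<d. x powi (b + s) * (q ^ (d - Suc i) * x ^ i))"
  proof (rule sum.reindex_bij_witness[where i = "\<lambda>i. b + int i" and j = "\<lambda>t. nat (t - b)"])
    fix t assume t: "t \<in> {b..a}"
    then have "int (d - Suc (nat (t - b))) = a - t"
      using d by (simp add: of_nat_diff d_def nat_less_iff Suc_le_eq)
    then have "q ^ (d - Suc (nat (t - b))) = q powi (a - t)"
      by (metis power_int_of_nat)
    moreover have "x ^ nat (t - b) = x powi (t - b)"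
      using t by (simp add: power_int_def)
    moreover have "x powi (b + s) * x powi (t - b) = x powi (t + s)"
      using power_int_add[of x "b + s" "t - b"] assms(1) by (simp add: add.commute)
    ultimately show "x powi (b + s) * (q ^ (d - Suc (nat (t - b))) * x ^ nat (t - b)) =
        x powi (t + s) * q powi (a - t)"
      by (simp add: mult_ac)
  qed (use d in auto)
  also have "(x - q) * \<dots> = x powi (b + s) * (x ^ d - q ^ d)"
    by (simp add: power_diff_sumr2 sum_distrib_left mult_ac)
  also have "x ^ d = x powi (a + 1 - b)"
    by (simp flip: d)
  also have "q ^ d = q powi (a + 1 - b)"
    by (simp flip: d)
  also have "x powi (b + s) * (x powi (a + 1 - b) - q powi (a + 1 - b)) =
      x powi (a + 1 + s) - q powi (a + 1 - b) * x powi (b + s)"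
    using power_int_add[of x "b + s" "a + 1 - b"] assms(1) by (simp add: right_diff_distrib ac_simps)
  finally show ?thesis by simp
qed

text \<open>With \<open>q\<close> the last variable, the last row of the numerator is geometric.
  After the column operation row \<open>i\<close> has the factor \<open>x (Suc i) - q\<close>;
  together these are the factors of the Vandermonde product that involve \<open>q\<close>. The
  remaining geometric sums, expanded by columns, give the numerators for the interlacing
  \<open>\<mu>\<close>.\<close>

lemma schur_ratio_branching:
  assumes lam: "length lam = Suc n" "sorted_wrt (\<ge>) lam"
    and x: "inj_on x {1..Suc n}" "\<forall>i\<in>{1..Suc n}. x i \<noteq> 0"
  shows "schur_ratio (Suc n) lam x =
    (\<Sum>\<mu>\<in>interlacing lam. schur_ratio n \<mu> x * x (Suc n) powi (sum_list lam - sum_list \<mu>))"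
proof -
  define q where "q = x (Suc n)"
  define l where "l j = lam ! j + int (Suc n) - int (Suc j)" for j
  have q: "q \<noteq> 0" using x(2) by (simp add: q_def)
  have x0: "x (Suc i) \<noteq> 0" if "i < n" for i using x(2) that by simp
  have xq: "x i - q \<noteq> 0" if "i \<in> {1..n}" for i
    using inj_onD[OF x(1), of i "Suc n"] that by (auto simp: q_def)
  define D where "D \<mu> = det (mat n n (\<lambda>(i, j). x (Suc i) powi (\<mu> ! j + int n - int (Suc j))))" for \<mu>
  let ?f = "\<lambda>i j t. (x (Suc i) - q) * (x (Suc i) powi (t + int n - int (Suc j)) * q powi (lam ! j - t))"
  have entry: "x (Suc i) powi l j - q powi (l j - l (Suc j)) * x (Suc i) powi l (Suc j) =
      (\<Sum>t\<in>{lam ! Suc j..lam ! j}. ?f i j t)" if "i < n" "j < n" for i j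
  proof -
    have le: "lam ! Suc j \<le> lam ! j"
      using lam that by (auto simp: sorted_wrt_iff_nth_less)
    show ?thesis
      using powi_geometric_sum[OF x0[OF \<open>i < n\<close>] q le, of "int n - int (Suc j)"]
      by (simp add: l_def sum_distrib_left algebra_simps)
  qed
  have "((\<lambda>\<mu>. det (mat n n (\<lambda>(i, j). ?f i j (\<mu> ! j)))) has_sum
      det (mat n n (\<lambda>(i, j). x (Suc i) powi l j - q powi (l j - l (Suc j)) * x (Suc i) powi l (Suc j))))
    (interlacing lam)"
    using has_sum_det_cols[of n ?f "\<lambda>j. {lam ! Suc j..lam ! j}", OF has_sum_finiteI[OF _ entry]]
    by (simp add: interlacing_def lam(1))
  then have sum: "det (mat n n (\<lambda>(i, j). x (Suc i) powi l j - q powi (l j - l (Suc j)) * x (Suc i) powi l (Suc j))) =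
      (\<Sum>\<mu>\<in>interlacing lam. det (mat n n (\<lambda>(i, j). ?f i j (\<mu> ! j))))"
    by (simp add: has_sum_finite_iff finite_interlacing)
  have summand: "q powi l n * det (mat n n (\<lambda>(i, j). ?f i j (\<mu> ! j))) =
      (\<Prod>i<n. x (Suc i) - q) * (D \<mu> * q powi (sum_list lam - sum_list \<mu>))"
    if "\<mu> \<in> interlacing lam" for \<mu>
  proof -
    \<comment> \<open>In the last column the shift is 0, so \<open>l n = lam ! n\<close> supplies
      the coordinate of \<open>lam\<close> that has no partner in \<open>\<mu>\<close>.\<close>
    have "(\<Sum>j<n. lam ! j - \<mu> ! j) + l n = sum_list lam - sum_list \<mu>"
      using that lam(1) by (simp add: interlacing_def sum_list_sum_nth atLeast0LessThan sum_subtractf l_def)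
    then have "(\<Prod>j<n. q powi (lam ! j - \<mu> ! j)) * q powi l n = q powi (sum_list lam - sum_list \<mu>)"
      using q by (simp add: powi_sum flip: power_int_add)
    then show ?thesis
      using det_scale_rows_cols[of n "\<lambda>i. x (Suc i) - q" "\<lambda>j. q powi (lam ! j - \<mu> ! j)"
          "\<lambda>i j. x (Suc i) powi (\<mu> ! j + int n - int (Suc j))"]
      by (simp add: D_def mult_ac)
  qed
  have "det (mat (Suc n) (Suc n) (\<lambda>(i, j). x (Suc i) powi l j)) =
    q powi l n * det (mat n n (\<lambda>(i, j). x (Suc i) powi l j - q powi (l j - l (Suc j)) * x (Suc i) powi l (Suc j)))"
    using det_geometric_last_row[of n "\<lambda>i j. x (Suc i) powi l j" 1 q l] q by (simp add: q_def)
  also have "\<dots> = (\<Prod>i<n. x (Suc i) - q) * (\<Sum>\<mu>\<in>interlacing lam. D \<mu> * q powi (sum_list lam - sum_list \<mu>))"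
    unfolding sum sum_distrib_left by (rule sum.cong[OF refl summand])
  also have "(\<Prod>i<n. x (Suc i) - q) = (\<Prod>i=1..<Suc n. x i - q)"
    unfolding atLeastLessThanSuc_atLeastAtMost One_nat_def prod.atLeast1_atMost_eq ..
  finally have det: "det (mat (Suc n) (Suc n) (\<lambda>(i, j). x (Suc i) powi l j)) =
    (\<Prod>i=1..<Suc n. x i - q) * (\<Sum>\<mu>\<in>interlacing lam. D \<mu> * q powi (sum_list lam - sum_list \<mu>))" .
  have "(\<Prod>i=1..<Suc n. x i - q) \<noteq> 0"
    using xq by simp
  then show ?thesis
    unfolding schur_ratio_def l_def[symmetric] det D_def[symmetric]
    by (simp add: q_def[symmetric] sum_divide_distrib)
qed

text \<open>The definition indexes monomials by their exponents; here several indices may share an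
  exponent, and their coefficients are collected over the fibres of \<open>w\<close>.\<close>

lemma laurent_polynomialI:
  fixes w :: "'i \<Rightarrow> nat \<Rightarrow> int"
  assumes "finite I" and f: "\<And>x. f x = (\<Sum>i\<in>I. b i * (\<Prod>k=1..n. x k powi w i k))"
  shows "laurent_polynomial n f"
  unfolding laurent_polynomial_def
proof (intro exI conjI allI)
  show "finite (w ` I)" using assms(1) by simp
  show "f x = (\<Sum>e\<in>w ` I. (\<Sum>i\<in>{i\<in>I. w i = e}. b i) * (\<Prod>k=1..n. x k powi e k))" for x
    unfolding f by (subst sum.image_gen[OF assms(1), of _ w]) (auto simp: sum_distrib_right intro!: sum.cong)
qed

lemma laurent_polynomial_sum:
  assumes "finite A" "\<And>a. a \<in> A \<Longrightarrow> laurent_polynomial n (f a)"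
  shows "laurent_polynomial n (\<lambda>x. \<Sum>a\<in>A. f a x)"
proof -
  have "\<forall>a\<in>A. \<exists>E b. finite E \<and> (\<forall>x. f a x = (\<Sum>e\<in>E. b e * (\<Prod>k=1..n. x k powi e k)))"
    using assms(2) unfolding laurent_polynomial_def by blast
  then obtain E b where E: "\<And>a. a \<in> A \<Longrightarrow> finite (E a)"
    "\<And>a x. a \<in> A \<Longrightarrow> f a x = (\<Sum>e\<in>E a. b a e * (\<Prod>k=1..n. x k powi e k))"
    by metis
  show ?thesis
    by (rule laurent_polynomialI[where I = "Sigma A E" and b = "\<lambda>(a, e). b a e" and w = snd])
      (use assms(1) E in \<open>auto simp: sum.Sigma case_prod_unfold\<close>)
qed

lemma laurent_polynomial_mult_power:
  assumes "laurent_polynomial n f"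
  shows "laurent_polynomial (Suc n) (\<lambda>x. f x * x (Suc n) powi m)"
proof -
  obtain E b where "finite E" "\<And>x. f x = (\<Sum>e\<in>E. b e * (\<Prod>k=1..n. x k powi e k))"
    using assms unfolding laurent_polynomial_def by blast
  then show ?thesis
    by (intro laurent_polynomialI[where I = E and b = b and w = "\<lambda>e. e(Suc n := m)"])
      (auto simp: sum_distrib_right mult.assoc intro!: sum.cong prod.cong)
qed

text \<open>The branching rule has monomials as coefficients, so one induction yields both a Laurent
  polynomial that extends the ratio and its positivity at positive points.\<close>

lemma schur_ratio_laurent_polynomial:
  assumes "length lam = n" "sorted_wrt (\<ge>) lam"
  shows "\<exists>f. laurent_polynomial n f \<and>
    (\<forall>x. inj_on x {1..n} \<and> (\<forall>i\<in>{1..n}. x i \<noteq> 0) \<longrightarrow> f x = schur_ratio n lam x) \<and>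
    (\<forall>x. (\<forall>i\<in>{1..n}. x i > 0) \<longrightarrow> f x > 0)"
  using assms
proof (induction n arbitrary: lam)
  case 0
  have "laurent_polynomial 0 (\<lambda>_. 1)"
    by (rule laurent_polynomialI[where I = "{()}" and b = "\<lambda>_. 1"]) auto
  then show ?case by (intro exI[of _ "\<lambda>_. 1"]) (simp add: schur_ratio_def)
next
  case (Suc n)
  have "\<forall>\<mu>\<in>interlacing lam. \<exists>f. laurent_polynomial n f \<and>
    (\<forall>x. inj_on x {1..n} \<and> (\<forall>i\<in>{1..n}. x i \<noteq> 0) \<longrightarrow> f x = schur_ratio n \<mu> x) \<and>
    (\<forall>x. (\<forall>i\<in>{1..n}. x i > 0) \<longrightarrow> f x > 0)" (is "\<forall>\<mu>\<in>_. ?Q \<mu>")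
  proof
    fix \<mu> assume \<mu>: "\<mu> \<in> interlacing lam"
    then have "length \<mu> = n"
      using Suc.prems(1) by (simp add: interlacing_def)
    then show "?Q \<mu>"
      using sorted_wrt_interlacing[OF \<mu>] by (rule Suc.IH)
  qed
  then obtain f where f: "\<And>\<mu>. \<mu> \<in> interlacing lam \<Longrightarrow> laurent_polynomial n (f \<mu>)"
    "\<And>\<mu> x. \<mu> \<in> interlacing lam \<Longrightarrow> inj_on x {1..n} \<Longrightarrow> \<forall>i\<in>{1..n}. x i \<noteq> 0 \<Longrightarrow> f \<mu> x = schur_ratio n \<mu> x"
    "\<And>\<mu> x. \<mu> \<in> interlacing lam \<Longrightarrow> \<forall>i\<in>{1..n}. x i > 0 \<Longrightarrow> f \<mu> x > 0"
    by metis
  \<comment> \<open>Strict positivity requires that the branching sum is not empty.\<close>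
  have "butlast lam \<in> interlacing lam"
    using Suc.prems by (auto simp: interlacing_def nth_butlast sorted_wrt_iff_nth_less)
  then have ne: "interlacing lam \<noteq> {}" by blast
  let ?F = "\<lambda>x. \<Sum>\<mu>\<in>interlacing lam. f \<mu> x * x (Suc n) powi (sum_list lam - sum_list \<mu>)"
  show ?case
  proof (intro exI[of _ ?F] conjI allI impI)
    show "laurent_polynomial (Suc n) ?F"
      by (intro laurent_polynomial_sum laurent_polynomial_mult_power f finite_interlacing)
    show "?F x = schur_ratio (Suc n) lam x"
      if "inj_on x {1..Suc n} \<and> (\<forall>i\<in>{1..Suc n}. x i \<noteq> 0)" for x
    proof -
      have "inj_on x {1..n}"
        using that by (auto intro: inj_on_subset)
      then show ?thesis
        using that by (subst schur_ratio_branching[OF Suc.prems]) (auto intro!: sum.cong simp: f(2))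
    qed
    show "?F x > 0" if "\<forall>i\<in>{1..Suc n}. x i > 0" for x
      using that by (intro sum_pos finite_interlacing ne mult_pos_pos f(3) zero_less_power_int) auto
  qed
qed

lemma tendsto_laurent_polynomial:
  assumes "laurent_polynomial n f" "\<And>i. i \<in> {1..n} \<Longrightarrow> ((\<lambda>t. x t i) \<longlongrightarrow> y i) F"
    "\<And>i. i \<in> {1..n} \<Longrightarrow> y i \<noteq> 0"
  shows "((\<lambda>t. f (x t)) \<longlongrightarrow> f y) F"
proof -
  obtain E b where f: "f = (\<lambda>x. \<Sum>e\<in>E. b e * (\<Prod>k=1..n. x k powi e k))"
    using assms(1) unfolding laurent_polynomial_def by blast
  show ?thesis
    unfolding f by (intro tendsto_sum tendsto_mult tendsto_const tendsto_prod tendsto_power_int assms(2,3))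
qed

text \<open>The polynomial chosen by \<open>SOME\<close> need not a priori be the positive one built
  by branching. Both agree with the ratio at distinct nonzero points; such points approach
  \<open>\<xi>\<close>, and continuity gives equality there.\<close>

lemma schur_pos:
  assumes lam: "length lam = n" "sorted_wrt (\<ge>) lam"
    and pos: "\<forall>i\<ge>1. \<xi> i > 0" and mono: "mono_on {1..} \<xi>"
  shows "schur n lam \<xi> > 0"
proof -
  let ?P = "\<lambda>f. laurent_polynomial n f \<and>
    (\<forall>x. inj_on x {1..n} \<and> (\<forall>i\<in>{1..n}. x i \<noteq> 0) \<longrightarrow> f x = schur_ratio n lam x)"
  obtain f where f: "?P f" "f \<xi> > 0"
    using schur_ratio_laurent_polynomial[OF lam] pos by auto
  have s: "?P (schur n lam)"
    unfolding schur_def using f(1) by (rule someI[of ?P])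
  \<comment> \<open>For \<open>t > 0\<close> the added term makes the weakly increasing positive
    sequence strictly increasing, which separates coinciding coordinates.\<close>
  let ?x = "\<lambda>t i. \<xi> i + t * real i"
  have x: "((\<lambda>t. ?x t i) \<longlongrightarrow> \<xi> i) (at_right 0)" for i
    by (rule tendsto_eq_intros | simp)+
  have nz: "\<xi> i \<noteq> 0" if "i \<in> {1..n}" for i
    using pos that by (metis atLeastAtMost_iff less_irrefl)
  have eq: "f (?x t) = schur n lam (?x t)" if "t > 0" for t
  proof -
    have "?x t i < ?x t j" if "1 \<le> i" "i < j" for i j
      using mono_onD[OF mono, of i j] that \<open>t > 0\<close> by (auto intro: add_le_less_mono)
    then have "inj_on (?x t) {1..n}"
      by (intro linorder_inj_onI) (auto simp: less_le)
    moreover have "?x t i \<noteq> 0" if "i \<in> {1..n}" for i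
    proof -
      have "\<xi> i > 0" "t * real i \<ge> 0"
        using pos that \<open>t > 0\<close> by auto
      then show ?thesis by linarith
    qed
    ultimately have "f (?x t) = schur_ratio n lam (?x t)" "schur n lam (?x t) = schur_ratio n lam (?x t)"
      using f(1) s by blast+
    then show ?thesis by simp
  qed
  have lim_f: "((\<lambda>t. f (?x t)) \<longlongrightarrow> f \<xi>) (at_right 0)"
    by (rule tendsto_laurent_polynomial[OF conjunct1[OF f(1)] x nz])
  have "((\<lambda>t. schur n lam (?x t)) \<longlongrightarrow> schur n lam \<xi>) (at_right 0)"
    by (rule tendsto_laurent_polynomial[OF conjunct1[OF s] x nz])
  then have "((\<lambda>t. f (?x t)) \<longlongrightarrow> schur n lam \<xi>) (at_right 0)"
    by (rule Lim_transform_eventually)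
      (rule eventually_mono[OF eventually_at_right_less[of 0]], rule eq[symmetric])
  then have "f \<xi> = schur n lam \<xi>"
    by (rule tendsto_unique[OF trivial_limit_at_right_real lim_f])
  then show ?thesis using f(2) by simp
qed

subsection \<open>The transition matrices and the link\<close>

definition GT :: "nat \<Rightarrow> int list set" where
  "GT n = {lam. length lam = n \<and> sorted_wrt (\<ge>) lam}"

lemma GT_nth_Suc: "lam \<in> GT n \<Longrightarrow> Suc i < n \<Longrightarrow> lam ! Suc i \<le> lam ! i"
  by (auto simp: GT_def sorted_wrt_iff_nth_less)

lemma GT_iff_nth_Suc: "lam \<in> GT n \<longleftrightarrow> length lam = n \<and> (\<forall>i. Suc i < n \<longrightarrow> lam ! Suc i \<le> lam ! i)"
  unfolding GT_def by (auto simp: sorted_wrt_iff_nth_Suc_transp transp_def)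

lemma interlacing_GT: "\<mu> \<in> interlacing lam \<Longrightarrow> length lam = Suc n \<Longrightarrow> \<mu> \<in> GT n"
  by (simp add: GT_def sorted_wrt_interlacing) (simp add: interlacing_def)

text \<open>Each \<open>\<kappa> ! i\<close> lies between \<open>\<mu> ! Suc i\<close> and
  \<open>\<mu> ! i\<close>, so every point of the box cut out by \<open>\<kappa>\<close> is already
  a signature.\<close>

lemma GT_of_interlacing: "\<kappa> \<in> interlacing \<mu> \<Longrightarrow> length \<mu> = Suc n \<Longrightarrow> \<mu> \<in> GT (Suc n)"
  unfolding GT_iff_nth_Suc interlacing_def by auto

text \<open>The commutation with the link, stripped of Schur functions and normalising factors:
  \<open>q\<close> stands for the last variable and \<open>S\<close> for the value of
  \<open>g\<close> there.\<close>

lemma has_sum_det_interlacing: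
  fixes c :: "int \<Rightarrow> real" and q :: real
  assumes S: "((\<lambda>k. c k * q powi k) has_sum S) UNIV" and q: "q \<noteq> 0"
    and lam: "lam \<in> GT (Suc n)" and \<kappa>: "\<kappa> \<in> GT n"
  shows "((\<lambda>\<mu>. det (mat (Suc n) (Suc n) (\<lambda>(i, j). c (\<mu> ! i - int i - lam ! j + int j))) *
        q powi (sum_list \<mu> - sum_list \<kappa>)) has_sum
      S * (\<Sum>\<theta>\<in>interlacing lam. q powi (sum_list lam - sum_list \<theta>) *
        det (mat n n (\<lambda>(i, j). c (\<kappa> ! i - int i - \<theta> ! j + int j)))))
    {\<mu>. length \<mu> = Suc n \<and> \<kappa> \<in> interlacing \<mu>}"
proof -
  define l where "l j = lam ! j - int j" for j
  define k where "k i = \<kappa> ! i - int i" for i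
  define h where "h j y = c (y - l j) * q powi y" for j y
  \<comment> \<open>A half-line for \<open>i < n\<close>, all integers for \<open>i = n\<close>. The
    differences \<open>U i - U (i - 1)\<close>, shifted by \<open>i\<close>, are the intervals
    \<open>B i\<close> for \<open>\<mu> ! i\<close>; the first is unbounded above, the last below.
    So \<open>R\<close> holds the accumulated row sums.\<close>
  define U where "U i = {y. i < n \<longrightarrow> k i \<le> y}" for i
  define R where "R i j = (\<Sum>\<^sub>\<infinity>y\<in>U i. h j y)" for i j
  define B where "B i = {t. (i < n \<longrightarrow> \<kappa> ! i \<le> t) \<and> (0 < i \<longrightarrow> t \<le> \<kappa> ! (i - 1))}" for i
  let ?f = "\<lambda>i j t. q powi (t - int i) * c (t - int i - lam ! j + int j)"
  let ?I = "{\<mu>. length \<mu> = Suc n \<and> \<kappa> \<in> interlacing \<mu>}"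
  let ?D = "\<lambda>\<mu>. det (mat (Suc n) (Suc n) (\<lambda>(i, j). c (\<mu> ! i - int i - lam ! j + int j)))"
  let ?E = "\<lambda>\<theta>. det (mat n n (\<lambda>(i, j). c (\<kappa> ! i - int i - \<theta> ! j + int j)))"
  have len: "length lam = Suc n" "length \<kappa> = n" using lam \<kappa> by (auto simp: GT_def)

  have total: "(h j has_sum S * q powi l j) UNIV" for j
  proof -
    have "((\<lambda>k. c k * q powi k * q powi l j) has_sum S * q powi l j) UNIV"
      by (intro has_sum_cmult_left S)
    also have "?this \<longleftrightarrow> ?thesis"
      by (rule has_sum_reindex_bij_witness[where j = "\<lambda>k. k + l j" and i = "\<lambda>y. y - l j"])
        (auto simp: h_def power_int_add q)
    finally show ?thesis .
  qed
  have part: "h j summable_on A" for j A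
    using total by (metis summable_on_def summable_on_subset_banach subset_UNIV)
  have R: "(h j has_sum R i j) (U i)" for i j
    unfolding R_def by (intro has_sum_infsum part)

  have rows: "(?f i j has_sum R i j - (if i = 0 then 0 else R (i - 1) j)) (B i)" if "i < Suc n" for i j
  proof -
    have "k i < k (i - 1)" if "0 < i" "i < n"
      using GT_nth_Suc[OF \<kappa>, of "i - 1"] that by (simp add: k_def)
    then have "U (i - 1) \<subseteq> U i" if "i \<noteq> 0"
      using that \<open>i < Suc n\<close> by (auto simp: U_def)
    then have "(h j has_sum R i j - (if i = 0 then 0 else R (i - 1) j)) (U i - (if i = 0 then {} else U (i - 1)))"
      by (intro has_sum_Diff R) (auto simp: R)
    also have "?this \<longleftrightarrow> ?thesis"
      by (rule has_sum_reindex_bij_witness[where j = "\<lambda>y. y + int i" and i = "\<lambda>t. t - int i"])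
        (use that in \<open>auto simp: h_def l_def U_def B_def k_def of_nat_diff algebra_simps split: if_splits\<close>)
    finally show ?thesis .
  qed
  have box: "{\<mu>. length \<mu> = Suc n \<and> (\<forall>i<Suc n. \<mu> ! i \<in> B i)} = ?I"
  proof (intro Collect_cong conj_cong refl iffI)
    fix \<mu> :: "int list" assume \<mu>: "length \<mu> = Suc n"
    show "\<kappa> \<in> interlacing \<mu>" if *: "\<forall>i<Suc n. \<mu> ! i \<in> B i"
      using *[rule_format, of "Suc _"] * \<mu> len by (fastforce simp: interlacing_def B_def)
    show "\<forall>i<Suc n. \<mu> ! i \<in> B i" if "\<kappa> \<in> interlacing \<mu>"
    proof (intro allI impI)
      fix i assume "i < Suc n"
      then show "\<mu> ! i \<in> B i"
        using that \<mu> by (cases i) (auto simp: interlacing_def B_def)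
    qed
  qed
  \<comment> \<open>The row sums are successive differences of the rows of \<open>R\<close>, and
    taking these differences preserves the determinant.\<close>
  have det_R: "((\<lambda>\<mu>. det (mat (Suc n) (Suc n) (\<lambda>(i, j). ?f i j (\<mu> ! i)))) has_sum
      det (mat (Suc n) (Suc n) (\<lambda>(i, j). R i j))) ?I"
    unfolding box[symmetric] det_row_differences[of "Suc n" R, symmetric]
    by (rule has_sum_det_rows) (rule rows)

  have "R n j = S * q powi l j" for j
    using total[of j] by (simp add: R_def U_def infsumI)
  then have last: "det (mat (Suc n) (Suc n) (\<lambda>(i, j). R i j)) =
      S * q powi l n * det (mat n n (\<lambda>(i, j). R i j - q powi (l j - l (Suc j)) * R i (Suc j)))"
    using q by (intro det_geometric_last_row) auto
  \<comment> \<open>Columns \<open>j\<close> and \<open>Suc j\<close> of \<open>h\<close> agree up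
    to a shift by \<open>d\<close> and the factor \<open>q powi d\<close>. Hence the subtracted
    multiple is a tail of the series \<open>R i j\<close>, and \<open>d\<close> terms
    remain.\<close>
  have entry: "R i j - q powi (l j - l (Suc j)) * R i (Suc j) =
      (\<Sum>t\<in>{lam ! Suc j..lam ! j}. q powi k i * q powi (lam ! j - t) * c (k i - t + int j))"
    if "i < n" "j < n" for i j
  proof -
    define d where "d = l j - l (Suc j)"
    have d: "d \<ge> 0"
      using GT_nth_Suc[OF lam, of j] that by (simp add: d_def l_def)
    have shift: "h j (y + d) = q powi d * h (Suc j) y" for y
    proof -
      have "y + d - l j = y - l (Suc j)" by (simp add: d_def)
      then show ?thesis unfolding h_def using q by (simp only: power_int_add mult_ac simp_thms)
    qed
    have "((\<lambda>y. q powi d * h (Suc j) y) has_sum q powi d * R i (Suc j)) (U i)"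
      by (intro has_sum_cmult_right R)
    also have "?this \<longleftrightarrow> (h j has_sum q powi d * R i (Suc j)) {k i + d..}"
      by (rule has_sum_reindex_bij_witness[where j = "\<lambda>y. y + d" and i = "\<lambda>y. y - d"])
        (use that in \<open>auto simp: U_def shift\<close>)
    finally have "(h j has_sum R i j - q powi d * R i (Suc j)) (U i - {k i + d..})"
      using d that by (intro has_sum_Diff R) (auto simp: U_def)
    also have "U i - {k i + d..} = {k i..<k i + d}"
      using that by (auto simp: U_def)
    finally have "R i j - q powi d * R i (Suc j) = (\<Sum>y\<in>{k i..<k i + d}. h j y)"
      by (simp add: has_sum_finite_iff)
    \<comment> \<open>As \<open>d = lam ! j - lam ! Suc j + 1\<close>, the reflection takes the
      \<open>d\<close> values from \<open>k i\<close> upwards exactly to the closed interval for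
      \<open>\<theta> ! j\<close>, with \<open>k i\<close> going to \<open>lam ! j\<close>.\<close>
    also have "\<dots> = (\<Sum>t\<in>{lam ! Suc j..lam ! j}. q powi k i * q powi (lam ! j - t) * c (k i - t + int j))"
    proof (rule sum.reindex_bij_witness[where i = "\<lambda>t. k i + lam ! j - t" and j = "\<lambda>y. k i + lam ! j - y"])
      fix y
      have "q powi k i * q powi (y - k i) = q powi y"
        using q by (simp flip: power_int_add)
      then show "q powi k i * q powi (lam ! j - (k i + lam ! j - y)) * c (k i - (k i + lam ! j - y) + int j) = h j y"
        by (simp add: h_def l_def algebra_simps)
    qed (auto simp: d_def l_def)
    finally show ?thesis by (simp add: d_def)
  qed
  have "((\<lambda>\<theta>. det (mat n n (\<lambda>(i, j). q powi k i * q powi (lam ! j - \<theta> ! j) * c (k i - \<theta> ! j + int j)))) has_sum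
      det (mat n n (\<lambda>(i, j). R i j - q powi (l j - l (Suc j)) * R i (Suc j)))) (interlacing lam)"
    using has_sum_det_cols[of n "\<lambda>i j t. q powi k i * q powi (lam ! j - t) * c (k i - t + int j)"
        "\<lambda>j. {lam ! Suc j..lam ! j}", OF has_sum_finiteI[OF _ entry]]
    by (simp add: interlacing_def len(1))
  then have sum: "det (mat n n (\<lambda>(i, j). R i j - q powi (l j - l (Suc j)) * R i (Suc j))) =
      (\<Sum>\<theta>\<in>interlacing lam. det (mat n n (\<lambda>(i, j). q powi k i * q powi (lam ! j - \<theta> ! j) * c (k i - \<theta> ! j + int j))))"
    by (simp add: has_sum_finite_iff finite_interlacing)

  \<comment> \<open>The correction that undoes the row shifts: it turns the exponent of
    \<open>q\<close> into \<open>sum_list \<mu> - sum_list \<kappa>\<close> on one side and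
    \<open>sum_list lam - sum_list \<theta>\<close> on the other.\<close>
  define w where "w = q powi ((\<Sum>i<Suc n. int i) - sum_list \<kappa>)"
  have lhs: "det (mat (Suc n) (Suc n) (\<lambda>(i, j). ?f i j (\<mu> ! i))) * w = ?D \<mu> * q powi (sum_list \<mu> - sum_list \<kappa>)"
    if "\<mu> \<in> ?I" for \<mu>
  proof -
    have "(\<Prod>i<Suc n. q powi (\<mu> ! i - int i)) * w = q powi ((\<Sum>i<Suc n. \<mu> ! i - int i) + ((\<Sum>i<Suc n. int i) - sum_list \<kappa>))"
      unfolding w_def power_int_add[OF disjI1[OF q]] powi_sum[OF q] ..
    also have "(\<Sum>i<Suc n. \<mu> ! i - int i) + ((\<Sum>i<Suc n. int i) - sum_list \<kappa>) = sum_list \<mu> - sum_list \<kappa>"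
      using that unfolding sum_subtractf by (simp add: sum_list_sum_nth atLeast0LessThan)
    finally show ?thesis
      using det_scale_rows_cols[of "Suc n" "\<lambda>i. q powi (\<mu> ! i - int i)" "\<lambda>_. 1"
          "\<lambda>i j. c (\<mu> ! i - int i - lam ! j + int j)"] by (simp add: mult_ac)
  qed
  have rhs: "q powi l n * det (mat n n (\<lambda>(i, j). q powi k i * q powi (lam ! j - \<theta> ! j) * c (k i - \<theta> ! j + int j))) * w =
      q powi (sum_list lam - sum_list \<theta>) * ?E \<theta>" if "\<theta> \<in> interlacing lam" for \<theta>
  proof -
    have "q powi l n * ((\<Prod>i<n. q powi k i) * (\<Prod>j<n. q powi (lam ! j - \<theta> ! j))) * w =
      q powi (l n + ((\<Sum>i<n. k i) + (\<Sum>j<n. lam ! j - \<theta> ! j)) + ((\<Sum>i<Suc n. int i) - sum_list \<kappa>))"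
      unfolding w_def power_int_add[OF disjI1[OF q]] powi_sum[OF q] ..
    also have "l n + ((\<Sum>i<n. k i) + (\<Sum>j<n. lam ! j - \<theta> ! j)) + ((\<Sum>i<Suc n. int i) - sum_list \<kappa>) =
        sum_list lam - sum_list \<theta>"
      using that len by (simp add: l_def k_def sum_subtractf sum_list_sum_nth atLeast0LessThan interlacing_def)
    finally show ?thesis
      using det_scale_rows_cols[of n "\<lambda>i. q powi k i" "\<lambda>j. q powi (lam ! j - \<theta> ! j)" "\<lambda>i j. c (k i - \<theta> ! j + int j)"]
      by (simp add: mult_ac k_def diff_diff_eq)
  qed
  have "((\<lambda>\<mu>. det (mat (Suc n) (Suc n) (\<lambda>(i, j). ?f i j (\<mu> ! i))) * w) has_sum
      det (mat (Suc n) (Suc n) (\<lambda>(i, j). R i j)) * w) ?I"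
    by (intro has_sum_cmult_left det_R)
  also have "?this \<longleftrightarrow> ((\<lambda>\<mu>. ?D \<mu> * q powi (sum_list \<mu> - sum_list \<kappa>)) has_sum
      det (mat (Suc n) (Suc n) (\<lambda>(i, j). R i j)) * w) ?I"
    by (rule has_sum_cong) (rule lhs)
  also have "det (mat (Suc n) (Suc n) (\<lambda>(i, j). R i j)) * w =
      S * (\<Sum>\<theta>\<in>interlacing lam. q powi l n *
        det (mat n n (\<lambda>(i, j). q powi k i * q powi (lam ! j - \<theta> ! j) * c (k i - \<theta> ! j + int j))) * w)"
    unfolding last sum by (simp add: sum_distrib_left sum_distrib_right mult_ac)
  also have "\<dots> = S * (\<Sum>\<theta>\<in>interlacing lam. q powi (sum_list lam - sum_list \<theta>) * ?E \<theta>)"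
    using rhs by simp
  finally show ?thesis .
qed

section \<open>Transition matrices commute with each other and with the link\<close>

lemma laurent_expansion_real_point:
  assumes "laurent_expansion r R g c" "0 < r" "r \<le> x" "x \<le> R"
  shows "((\<lambda>k. c k * x powi k) has_sum Re (g (of_real x))) UNIV"
proof -
  have "((\<lambda>k. of_real (c k) * of_real x powi k) has_sum g (of_real x)) UNIV"
    using assms by (simp add: laurent_expansion_def)
  then have "((\<lambda>k. Re (of_real (c k) * of_real x powi k)) has_sum Re (g (of_real x))) UNIV"
    by (rule has_sum_bounded_linear[OF bounded_linear_Re])
  then show ?thesis
    by (simp flip: of_real_power_int of_real_mult)
qed

text \<open>The coefficients are real, so \<open>g\<close> is real at real points; nonvanishing of
  \<open>g\<close> there therefore passes to its real part.\<close>

lemma laurent_expansion_real_value: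
  assumes "laurent_expansion r R g c" "0 < r" "r \<le> x" "x \<le> R"
  shows "g (of_real x) = of_real (Re (g (of_real x)))"
proof -
  have "((\<lambda>k. of_real (c k) * of_real x powi k) has_sum g (of_real x)) UNIV"
    using assms by (simp add: laurent_expansion_def)
  moreover have "((\<lambda>k. complex_of_real (c k * x powi k)) has_sum of_real (Re (g (of_real x)))) UNIV"
    by (intro has_sum_of_real laurent_expansion_real_point[OF assms])
  ultimately show ?thesis
    by (auto simp: of_real_power_int intro: has_sum_unique)
qed

definition admissible :: "(nat \<Rightarrow> real) \<Rightarrow> bool" where
  "admissible \<xi> \<longleftrightarrow> (\<forall>i\<ge>1. \<xi> i > 0) \<and> mono_on {1..} \<xi>"

lemma admissible_pos: "admissible \<xi> \<Longrightarrow> 1 \<le> i \<Longrightarrow> 0 < \<xi> i"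
  by (simp add: admissible_def)

lemma admissible_mono: "admissible \<xi> \<Longrightarrow> 1 \<le> i \<Longrightarrow> i \<le> j \<Longrightarrow> \<xi> i \<le> \<xi> j"
  by (auto simp: admissible_def mono_on_def)

lemma admissible_schur_pos: "admissible \<xi> \<Longrightarrow> lam \<in> GT n \<Longrightarrow> 0 < schur n lam \<xi>"
  by (simp add: admissible_def GT_def schur_pos)

text \<open>The case distinction in the definition disappears, because a determinant of size 0 is 1.\<close>
lemma trans_prob_eq:
  assumes \<xi>: "admissible \<xi>" and c: "laurent_expansion (\<xi> 1) (\<xi> N) g c" and n: "n \<le> N"
    and lam: "lam \<in> GT n" "\<mu> \<in> GT n"
  shows "trans_prob \<xi> n g lam \<mu> = (\<Prod>i=1..n. 1 / Re (g (of_real (\<xi> i)))) *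
    det (mat n n (\<lambda>(i, j). c (\<mu> ! i - int i - lam ! j + int j))) * (schur n \<mu> \<xi> / schur n lam \<xi>)"
proof (cases "n = 0")
  case True
  then have "lam = \<mu>" using lam by (simp add: GT_def)
  then show ?thesis
    using True admissible_schur_pos[OF \<xi> lam(1)] by (simp add: trans_prob_def)
next
  case False
  then have "laurent_coeffs (\<xi> 1) (\<xi> n) g = c"
    using n by (intro laurent_coeffs_eq laurent_expansion_subset[OF c] admissible_pos[OF \<xi>] admissible_mono[OF \<xi>]) auto
  then show ?thesis
    using False by (simp add: trans_prob_def)
qed

text \<open>Subtracting the index makes weak decrease strict, which identifies signatures with the
  index set of the Cauchy-Binet sum.\<close>

lemma GT_strictly_decreasing_bij:
  "bij_betw (\<lambda>lam. map (\<lambda>i. lam ! i - int i) [0..<n]) (GT n) {ms. length ms = n \<and> sorted_wrt (>) ms}"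
proof -
  have shift: "b - int (Suc i) < a - int i \<longleftrightarrow> b \<le> a" "b + int (Suc i) \<le> a + int i \<longleftrightarrow> b < a" for a b i
    by auto
  show ?thesis
    by (rule bij_betwI[where g = "\<lambda>ms. map (\<lambda>i. ms ! i + int i) [0..<n]"])
      (auto simp: GT_iff_nth_Suc sorted_wrt_iff_nth_Suc_transp transp_def shift
        simp del: of_nat_Suc intro!: nth_equalityI)
qed

lemma trans_prob_composition:
  assumes \<xi>: "admissible \<xi>" and n: "1 \<le> n"
    and c: "laurent_expansion (\<xi> 1) (\<xi> n) g c" and d: "laurent_expansion (\<xi> 1) (\<xi> n) h d"
    and lam: "lam \<in> GT n" "\<kappa> \<in> GT n"
  shows "((\<lambda>\<mu>. trans_prob \<xi> n g lam \<mu> * trans_prob \<xi> n h \<mu> \<kappa>) has_sum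
    (\<Prod>i=1..n. 1 / Re (g (of_real (\<xi> i)))) * (\<Prod>i=1..n. 1 / Re (h (of_real (\<xi> i)))) *
    det (mat n n (\<lambda>(i, j). \<Sum>\<^sub>\<infinity>m. c m * d (\<kappa> ! i - int i - lam ! j + int j - m))) *
    (schur n \<kappa> \<xi> / schur n lam \<xi>)) (GT n)"
proof -
  define K where "K = (\<Prod>i=1..n. 1 / Re (g (of_real (\<xi> i)))) * (\<Prod>i=1..n. 1 / Re (h (of_real (\<xi> i)))) *
    (schur n \<kappa> \<xi> / schur n lam \<xi>)"
  have conv: "((\<lambda>y. d (\<kappa> ! i - int i - y) * c (y - (lam ! j - int j))) has_sum
      (\<Sum>\<^sub>\<infinity>m. c m * d (\<kappa> ! i - int i - lam ! j + int j - m))) UNIV" for i j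
  proof -
    have "((\<lambda>m. c m * d (\<kappa> ! i - int i - lam ! j + int j - m)) has_sum
      (\<Sum>\<^sub>\<infinity>m. c m * d (\<kappa> ! i - int i - lam ! j + int j - m))) UNIV"
      using n by (intro has_sum_infsum laurent_convolution_summable[OF c d] admissible_pos[OF \<xi>] admissible_mono[OF \<xi>]) auto
    also have "?this \<longleftrightarrow> ?thesis"
      by (rule has_sum_reindex_bij_witness[where j = "\<lambda>m. m + (lam ! j - int j)" and i = "\<lambda>y. y - (lam ! j - int j)"])
        (auto simp: algebra_simps)
    finally show ?thesis .
  qed
  \<comment> \<open>Rows are indexed by the target signature, so the coefficients \<open>d\<close>
    of the second transition form the left factor.\<close>
  have "((\<lambda>ms. K * (det (mat n n (\<lambda>(i, j). d (\<kappa> ! i - int i - ms ! j))) *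
      det (mat n n (\<lambda>(i, j). c (ms ! i - (lam ! j - int j)))))) has_sum
    K * det (mat n n (\<lambda>(i, j). \<Sum>\<^sub>\<infinity>m. c m * d (\<kappa> ! i - int i - lam ! j + int j - m))))
    {ms. length ms = n \<and> sorted_wrt (>) ms}"
    by (intro has_sum_cmult_right cauchy_binet_has_sum conv)
  also have "?this \<longleftrightarrow> ((\<lambda>\<mu>. trans_prob \<xi> n g lam \<mu> * trans_prob \<xi> n h \<mu> \<kappa>) has_sum
    K * det (mat n n (\<lambda>(i, j). \<Sum>\<^sub>\<infinity>m. c m * d (\<kappa> ! i - int i - lam ! j + int j - m)))) (GT n)"
  proof (subst has_sum_reindex_bij_betw[OF GT_strictly_decreasing_bij, symmetric], rule has_sum_cong)
    fix \<mu> assume \<mu>: "\<mu> \<in> GT n"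
    have "mat n n (\<lambda>(i, j). d (\<kappa> ! i - int i - map (\<lambda>i. \<mu> ! i - int i) [0..<n] ! j)) =
        mat n n (\<lambda>(i, j). d (\<kappa> ! i - int i - \<mu> ! j + int j))"
      "mat n n (\<lambda>(i, j). c (map (\<lambda>i. \<mu> ! i - int i) [0..<n] ! i - (lam ! j - int j))) =
        mat n n (\<lambda>(i, j). c (\<mu> ! i - int i - lam ! j + int j))"
      by (auto simp: algebra_simps)
    then show "K * (det (mat n n (\<lambda>(i, j). d (\<kappa> ! i - int i - map (\<lambda>i. \<mu> ! i - int i) [0..<n] ! j))) *
        det (mat n n (\<lambda>(i, j). c (map (\<lambda>i. \<mu> ! i - int i) [0..<n] ! i - (lam ! j - int j))))) =
      trans_prob \<xi> n g lam \<mu> * trans_prob \<xi> n h \<mu> \<kappa>"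
      using admissible_schur_pos[OF \<xi> \<mu>]
      by (simp add: trans_prob_eq[OF \<xi> c order.refl lam(1) \<mu>] trans_prob_eq[OF \<xi> d order.refl \<mu> lam(2)] K_def)
  qed
  finally show ?thesis by (simp add: K_def mult_ac)
qed

text \<open>Convolution is symmetric under replacing \<open>m\<close> by \<open>k - m\<close>. The
  common value \<open>T\<close> records summability and equality of both sides at once.\<close>

lemma trans_prob_commute:
  assumes \<xi>: "admissible \<xi>" and n: "1 \<le> n"
    and c: "laurent_expansion (\<xi> 1) (\<xi> n) g c" and d: "laurent_expansion (\<xi> 1) (\<xi> n) h d"
    and lam: "lam \<in> GT n" "\<kappa> \<in> GT n"
  obtains T where "((\<lambda>\<mu>. trans_prob \<xi> n g lam \<mu> * trans_prob \<xi> n h \<mu> \<kappa>) has_sum T) (GT n)"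
    "((\<lambda>\<theta>. trans_prob \<xi> n h lam \<theta> * trans_prob \<xi> n g \<theta> \<kappa>) has_sum T) (GT n)"
proof -
  have comm: "(\<Sum>\<^sub>\<infinity>m. d m * c (k - m)) = (\<Sum>\<^sub>\<infinity>m. c m * d (k - m))" for k
    by (rule infsum_reindex_bij_witness[where j = "\<lambda>m. k - m" and i = "\<lambda>m. k - m"]) (auto simp: mult.commute)
  show ?thesis
    using trans_prob_composition[OF \<xi> n c d lam] trans_prob_composition[OF \<xi> n d c lam]
    by (intro that) (simp_all add: comm mult_ac)
qed

lemma trans_prob_link_commute:
  assumes \<xi>: "admissible \<xi>" and c: "laurent_expansion (\<xi> 1) (\<xi> (Suc n)) g c"
    and nz: "g (of_real (\<xi> (Suc n))) \<noteq> 0" and lam: "lam \<in> GT (Suc n)" and \<kappa>: "\<kappa> \<in> GT n"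
  obtains T where "((\<lambda>\<mu>. trans_prob \<xi> (Suc n) g lam \<mu> * link \<xi> (Suc n) \<mu> \<kappa>) has_sum T) (GT (Suc n))"
    "((\<lambda>\<theta>. link \<xi> (Suc n) lam \<theta> * trans_prob \<xi> n g \<theta> \<kappa>) has_sum T) (GT n)"
proof
  define q where "q = \<xi> (Suc n)"
  define S where "S = Re (g (of_real q))"
  \<comment> \<open>The factors shared by both sides. Size \<open>Suc n\<close> has the further
    normalising factor \<open>1 / S\<close>, which cancels against the \<open>S\<close> from the
    determinant identity.\<close>
  define K where "K = (\<Prod>i=1..n. 1 / Re (g (of_real (\<xi> i)))) * (schur n \<kappa> \<xi> / schur (Suc n) lam \<xi>)"
  let ?E = "\<lambda>\<theta>. det (mat n n (\<lambda>(i, j). c (\<kappa> ! i - int i - \<theta> ! j + int j)))"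
  let ?D = "\<lambda>\<mu>. det (mat (Suc n) (Suc n) (\<lambda>(i, j). c (\<mu> ! i - int i - lam ! j + int j)))"
  let ?T = "K * (\<Sum>\<theta>\<in>interlacing lam. q powi (sum_list lam - sum_list \<theta>) * ?E \<theta>)"
  have q: "\<xi> 1 \<le> q" "0 < q"
    using admissible_mono[OF \<xi>, of 1 "Suc n"] admissible_pos[OF \<xi>, of "Suc n"] by (auto simp: q_def)
  have S: "((\<lambda>k. c k * q powi k) has_sum S) UNIV" "S \<noteq> 0"
    using laurent_expansion_real_point[OF c _ q(1)] laurent_expansion_real_value[OF c _ q(1)]
      admissible_pos[OF \<xi>, of 1] nz by (auto simp: q_def S_def)
  have link: "link \<xi> (Suc n) \<mu> \<theta> = (if \<theta> \<in> interlacing \<mu> then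
      q powi (sum_list \<mu> - sum_list \<theta>) * schur n \<theta> \<xi> / schur (Suc n) \<mu> \<xi> else 0)"
    if "\<mu> \<in> GT (Suc n)" "\<theta> \<in> GT n" for \<mu> \<theta>
    using that by (auto simp: link_def interlacing_def GT_def q_def)
  have "((\<lambda>\<mu>. K / S * (?D \<mu> * q powi (sum_list \<mu> - sum_list \<kappa>))) has_sum
      K / S * (S * (\<Sum>\<theta>\<in>interlacing lam. q powi (sum_list lam - sum_list \<theta>) * ?E \<theta>)))
    {\<mu>. length \<mu> = Suc n \<and> \<kappa> \<in> interlacing \<mu>}"
    using q by (intro has_sum_cmult_right has_sum_det_interlacing S lam \<kappa>) auto
  also have "K / S * (S * (\<Sum>\<theta>\<in>interlacing lam. q powi (sum_list lam - sum_list \<theta>) * ?E \<theta>)) = ?T"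
    using S(2) by simp
  also have "((\<lambda>\<mu>. K / S * (?D \<mu> * q powi (sum_list \<mu> - sum_list \<kappa>))) has_sum ?T)
      {\<mu>. length \<mu> = Suc n \<and> \<kappa> \<in> interlacing \<mu>} \<longleftrightarrow>
    ((\<lambda>\<mu>. trans_prob \<xi> (Suc n) g lam \<mu> * link \<xi> (Suc n) \<mu> \<kappa>) has_sum ?T) (GT (Suc n))"
  proof (rule has_sum_cong_neutral)
    fix \<mu> assume \<mu>: "\<mu> \<in> GT (Suc n) - {\<mu>. length \<mu> = Suc n \<and> \<kappa> \<in> interlacing \<mu>}"
    then have "\<kappa> \<notin> interlacing \<mu>"
      by (simp add: GT_def)
    then show "trans_prob \<xi> (Suc n) g lam \<mu> * link \<xi> (Suc n) \<mu> \<kappa> = 0"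
      using \<mu> \<kappa> by (simp add: link)
  next
    fix \<mu> assume "\<mu> \<in> {\<mu>. length \<mu> = Suc n \<and> \<kappa> \<in> interlacing \<mu>} \<inter> GT (Suc n)"
    then have \<mu>: "\<mu> \<in> GT (Suc n)" "\<kappa> \<in> interlacing \<mu>" by auto
    show "K / S * (?D \<mu> * q powi (sum_list \<mu> - sum_list \<kappa>)) = trans_prob \<xi> (Suc n) g lam \<mu> * link \<xi> (Suc n) \<mu> \<kappa>"
      using admissible_schur_pos[OF \<xi> \<mu>(1)]
      by (simp add: trans_prob_eq[OF \<xi> c order.refl lam \<mu>(1)] link[OF \<mu>(1) \<kappa>] \<mu>(2) K_def S_def
          prod.nat_ivl_Suc' q_def[symmetric] mult_ac)
  qed (use GT_of_interlacing in blast)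
  finally show "((\<lambda>\<mu>. trans_prob \<xi> (Suc n) g lam \<mu> * link \<xi> (Suc n) \<mu> \<kappa>) has_sum ?T) (GT (Suc n))" .
  have int: "interlacing lam \<subseteq> GT n"
    using lam interlacing_GT by (auto simp: GT_def)
  show "((\<lambda>\<theta>. link \<xi> (Suc n) lam \<theta> * trans_prob \<xi> n g \<theta> \<kappa>) has_sum ?T) (GT n)"
  proof (rule has_sum_finite_neutralI[OF finite_interlacing int])
    show "link \<xi> (Suc n) lam \<theta> * trans_prob \<xi> n g \<theta> \<kappa> = 0" if "\<theta> \<in> GT n - interlacing lam" for \<theta>
      using that lam by (simp add: link)
    show "?T = (\<Sum>\<theta>\<in>interlacing lam. link \<xi> (Suc n) lam \<theta> * trans_prob \<xi> n g \<theta> \<kappa>)"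
      unfolding sum_distrib_left
    proof (rule sum.cong[OF refl])
      fix \<theta> assume \<theta>: "\<theta> \<in> interlacing lam"
      then have \<theta>': "\<theta> \<in> GT n" using int by blast
      show "K * (q powi (sum_list lam - sum_list \<theta>) * ?E \<theta>) = link \<xi> (Suc n) lam \<theta> * trans_prob \<xi> n g \<theta> \<kappa>"
        using admissible_schur_pos[OF \<xi> \<theta>'] \<theta>
        by (simp add: trans_prob_eq[OF \<xi> c _ \<theta>' \<kappa>] link[OF lam \<theta>'] K_def mult_ac)
    qed
  qed
qed

section \<open>Signatures with infinite coordinates and their reduction to finite ones\<close>

lemma finite_part_simps [simp]:
  "finite_part [] = []"
  "finite_part (Fin a # xs) = a # finite_part xs"
  "finite_part (\<infinity> # xs) = finite_part xs"
  "finite_part (-\<infinity> # xs) = finite_part xs"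
  by (simp_all add: finite_part_def)

lemma finite_part_append_map_Fin: "finite_part (replicate m \<infinity> @ map Fin xs) = xs"
proof -
  have "finite_part (map Fin xs) = xs" by (induction xs) auto
  then show ?thesis by (induction m) auto
qed

text \<open>In a decreasing list no infinite entry can follow a finite one, so the infinite entries
  form a prefix. The inequality makes the truncated difference of lengths a true one.\<close>

lemma extended_list_eq:
  assumes "sorted_wrt (\<ge>) xs" "-\<infinity> \<notin> set xs"
  shows "length (finite_part xs) \<le> length xs \<and>
    xs = replicate (length xs - length (finite_part xs)) \<infinity> @ map Fin (finite_part xs)"
  using assms
proof (induction xs)
  case Nil
  show ?case by simp
next
  case (Cons x xs)
  then have IH: "length (finite_part xs) \<le> length xs"
    "xs = replicate (length xs - length (finite_part xs)) \<infinity> @ map Fin (finite_part xs)" by auto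
  show ?case
  proof (cases x)
    case (Fin a)
    then have "\<infinity> \<notin> set xs" using Cons.prems by auto
    then have "length xs - length (finite_part xs) = 0"
      using IH(2) by (metis UnI1 in_set_replicate set_append)
    then show ?thesis using Fin IH by simp
  next
    case Pinf
    then show ?thesis using IH by (simp add: Suc_diff_le)
  next
    case Minf
    then show ?thesis using Cons.prems by simp
  qed
qed

lemma GT_part_bij:
  assumes "k \<le> N"
  shows "bij_betw finite_part (GT_part N k) (GT k)"
proof (rule bij_betwI[where g = "\<lambda>xs. replicate (N - k) \<infinity> @ map Fin xs"])
  show "finite_part \<in> GT_part N k \<rightarrow> GT k"
  proof
    fix xs assume xs: "xs \<in> GT_part N k"
    then have "xs = replicate (N - k) \<infinity> @ map Fin (finite_part xs)"
      using extended_list_eq[of xs] by (simp add: GT_part_def GT_ext_def)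
    then have "sorted_wrt (\<ge>) (replicate (N - k) \<infinity> @ map Fin (finite_part xs))"
      using xs by (simp add: GT_part_def GT_ext_def)
    then show "finite_part xs \<in> GT k"
      using xs by (simp add: sorted_wrt_append sorted_wrt_map GT_part_def GT_def)
  qed
  show "(\<lambda>xs. replicate (N - k) \<infinity> @ map Fin xs) \<in> GT k \<rightarrow> GT_part N k"
  proof
    fix xs assume "xs \<in> GT k"
    moreover have "sorted_wrt (\<ge>) (replicate (N - k) (\<infinity> :: int extended))"
      by (simp add: sorted_wrt_iff_nth_less)
    ultimately show "replicate (N - k) \<infinity> @ map Fin xs \<in> GT_part N k"
      using assms by (auto simp: GT_part_def GT_ext_def GT_def sorted_wrt_append sorted_wrt_map finite_part_append_map_Fin)
  qed
  show "replicate (N - k) \<infinity> @ map Fin (finite_part xs) = xs" if "xs \<in> GT_part N k" for xs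
    using that extended_list_eq[of xs] by (simp add: GT_part_def GT_ext_def)
qed (simp add: finite_part_append_map_Fin)

text \<open>Transfers a sum over ordinary signatures to the stratum that carries the extended
  matrices; they vanish elsewhere.\<close>

lemma has_sum_GT_ext:
  assumes "k \<le> N" "(F has_sum T) (GT k)"
    and "\<And>\<mu>. \<mu> \<in> GT_part N k \<Longrightarrow> G \<mu> = F (finite_part \<mu>)"
    and "\<And>\<mu>. \<mu> \<in> GT_ext N - GT_part N k \<Longrightarrow> G \<mu> = 0"
  shows "(G has_sum T) (GT_ext N)"
proof -
  have "((\<lambda>\<mu>. F (finite_part \<mu>)) has_sum T) (GT_part N k)"
    using assms(2) by (subst has_sum_reindex_bij_betw[OF GT_part_bij[OF assms(1)]])
  also have "?this \<longleftrightarrow> ?thesis"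
    by (rule has_sum_cong_neutral) (use assms(3,4) in \<open>auto simp: GT_part_def\<close>)
  finally show ?thesis .
qed

theorem proposition3p3:
  fixes \<xi> :: "nat \<Rightarrow> real" and N :: nat and g :: "complex \<Rightarrow> complex"
    and lam \<kappa> :: "int extended list"
  assumes "\<forall>i\<ge>1. \<xi> i > 0"
    and "mono_on {1..} \<xi>"
    and "N \<ge> 1"
    and "g \<in> \<G> N \<xi>"
    and "lam \<in> GT_ext N"
    and "\<kappa> \<in> GT_ext (N - 1)"
  shows "(\<lambda>\<mu>. trans_ext \<xi> N g lam \<mu> * link_ext \<xi> N \<mu> \<kappa>) summable_on GT_ext N \<and>
         (\<lambda>\<theta>. link_ext \<xi> N lam \<theta> * trans_ext \<xi> (N - 1) g \<theta> \<kappa>) summable_on GT_ext (N - 1) \<and>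
         (\<Sum>\<^sub>\<infinity>\<mu>\<in>GT_ext N. trans_ext \<xi> N g lam \<mu> * link_ext \<xi> N \<mu> \<kappa>) =
         (\<Sum>\<^sub>\<infinity>\<theta>\<in>GT_ext (N - 1). link_ext \<xi> N lam \<theta> * trans_ext \<xi> (N - 1) g \<theta> \<kappa>)"
proof -
  define k where "k = length (finite_part lam)"
  \<comment> \<open>A link removes a finite coordinate only when all are finite; otherwise it
    removes an infinite one.\<close>
  define k' where "k' = (if k = N then N - 1 else k)"
  let ?L = "\<lambda>\<mu>. trans_ext \<xi> N g lam \<mu> * link_ext \<xi> N \<mu> \<kappa>"
  let ?R = "\<lambda>\<theta>. link_ext \<xi> N lam \<theta> * trans_ext \<xi> (N - 1) g \<theta> \<kappa>"
  have \<xi>: "admissible \<xi>"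
    using assms(1,2) by (simp add: admissible_def)
  have k: "k \<le> N"
    using extended_list_eq[of lam] assms(5) by (simp add: k_def GT_ext_def)
  then have k': "k' \<le> N - 1"
    using assms(3) by (auto simp: k'_def)
  obtain fs where fs: "set fs \<subseteq> elementary N \<xi>" "g = (\<lambda>z. \<Prod>f\<leftarrow>fs. f z)"
    using assms(4) by (auto simp: \<G>_def)
  have \<xi>N: "0 < \<xi> 1" "\<xi> 1 \<le> \<xi> N"
    using admissible_pos[OF \<xi>] admissible_mono[OF \<xi>] assms(3) by auto
  obtain c where c: "laurent_expansion (\<xi> 1) (\<xi> N) g c"
    using laurent_expansion_prod_list[OF fs(1) \<xi>N] by (auto simp: fs(2))
  have nz: "g (of_real (\<xi> N)) \<noteq> 0"
    using elementary_real_point_nonzero[OF _ \<xi>N order.refl] fs by (auto simp: prod_list_zero_iff)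
  have lam: "lam \<in> GT_part N k"
    using assms(5) by (simp add: GT_part_def k_def)
  then have lam': "finite_part lam \<in> GT k"
    using bij_betwE[OF GT_part_bij[OF k]] by blast
  \<comment> \<open>Transitions preserve the stratum, so either order of the two matrices reaches
    only the stratum \<open>k'\<close>; for other \<open>\<kappa>\<close> both sums are 0.\<close>
  have L: "?L \<mu> = (if \<mu> \<in> GT_part N k \<and> \<kappa> \<in> GT_part (N - 1) k' then
      trans_prob \<xi> k g (finite_part lam) (finite_part \<mu>) *
      (if k = N then link \<xi> N (finite_part \<mu>) (finite_part \<kappa>)
       else aux_trans \<xi> N k (finite_part \<mu>) (finite_part \<kappa>)) else 0)" for \<mu>
    using lam by (auto simp: trans_ext_def link_ext_def k_def[symmetric] k'_def) (auto simp: GT_part_def)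
  have R: "?R \<theta> = (if \<theta> \<in> GT_part (N - 1) k' \<and> \<kappa> \<in> GT_part (N - 1) k' then
      (if k = N then link \<xi> N (finite_part lam) (finite_part \<theta>)
       else aux_trans \<xi> N k (finite_part lam) (finite_part \<theta>)) *
      trans_prob \<xi> k' g (finite_part \<theta>) (finite_part \<kappa>) else 0)" for \<theta>
    by (auto simp: trans_ext_def link_ext_def k_def[symmetric] k'_def) (auto simp: GT_part_def)
  have "\<exists>T. (?L has_sum T) (GT_ext N) \<and> (?R has_sum T) (GT_ext (N - 1))"
  proof (cases "\<kappa> \<in> GT_part (N - 1) k'")
    case False
    then have "(?L has_sum 0) (GT_ext N)" "(?R has_sum 0) (GT_ext (N - 1))"
      unfolding L R by simp_all
    then show ?thesis by blast
  next
    case True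
    then have \<kappa>': "finite_part \<kappa> \<in> GT k'"
      using bij_betwE[OF GT_part_bij[OF k']] by blast
    \<comment> \<open>Below the top stratum the auxiliary matrix comes from an admissible function
      only if \<open>1 \<le> k\<close> and \<open>\<xi> k < \<xi> N\<close>; the other two
      possibilities are degenerate.\<close>
    consider "k = N" | "k = 0" "k \<noteq> N" | "1 \<le> k" "k < N" "\<xi> k = \<xi> N" | "1 \<le> k" "k < N" "\<xi> k < \<xi> N"
      using k admissible_mono[OF \<xi>, of k N] by fastforce
    then obtain T where T: "((\<lambda>\<mu>. trans_prob \<xi> k g (finite_part lam) \<mu> *
        (if k = N then link \<xi> N \<mu> (finite_part \<kappa>) else aux_trans \<xi> N k \<mu> (finite_part \<kappa>))) has_sum T) (GT k)"
      "((\<lambda>\<theta>. (if k = N then link \<xi> N (finite_part lam) \<theta> else aux_trans \<xi> N k (finite_part lam) \<theta>) *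
        trans_prob \<xi> k' g \<theta> (finite_part \<kappa>)) has_sum T) (GT k')"
    proof cases
      case 1
      obtain n where n: "N = Suc n" using assms(3) by (cases N) auto
      show ?thesis
        using trans_prob_link_commute[of \<xi> n g c "finite_part lam" "finite_part \<kappa>"] \<xi> c nz lam' \<kappa>' 1 n that
        by (auto simp: k'_def)
    next
      case 2
      have "GT 0 = {[]}" by (auto simp: GT_def)
      moreover have "trans_prob \<xi> 0 f = (\<lambda>_ _. 1)" for f
        by (simp add: trans_prob_def fun_eq_iff)
      ultimately show ?thesis
        using 2 by (intro that[of 1]) (simp_all add: k'_def aux_trans_def has_sum_finite_iff)
    next
      case 3
      \<comment> \<open>At \<open>i = k\<close> the function has its pole; division by 0 gives 0, so
        the normalising product, the auxiliary matrix and both sums vanish.\<close>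
      then have "(\<Prod>i=1..k. 1 / Re (inverse (1 - of_real (inverse (\<xi> N)) * of_real (\<xi> i)))) = 0"
        using admissible_pos[OF \<xi>, of k] by (intro prod_zero bexI[of _ k]) auto
      then have "aux_trans \<xi> N k = (\<lambda>_ _. 0)"
        using 3 by (simp add: aux_trans_def trans_prob_def fun_eq_iff)
      then show ?thesis
        using 3 by (intro that[of 0]) auto
    next
      case 4
      let ?h = "\<lambda>z. inverse (1 - of_real (inverse (\<xi> N)) * z) :: complex"
      have pos: "\<xi> 1 > 0" "\<xi> 1 \<le> \<xi> k" "\<xi> k > 0"
        using admissible_pos[OF \<xi>] admissible_mono[OF \<xi>] 4 by auto
      \<comment> \<open>\<open>\<xi> k < \<xi> N\<close> places the pole \<open>\<xi> N\<close>
        outside the annulus of size \<open>k\<close>.\<close>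
      then have "?h \<in> elementary k \<xi>"
        using 4 unfolding elementary_def by (auto intro!: exI[of _ "inverse (\<xi> N)"])
      then obtain d where d: "laurent_expansion (\<xi> 1) (\<xi> k) ?h d"
        using laurent_expansion_elementary pos by blast
      have "laurent_expansion (\<xi> 1) (\<xi> k) g c"
        using laurent_expansion_subset[OF c] 4 by simp
      then show ?thesis
        using trans_prob_commute[OF \<xi> \<open>1 \<le> k\<close> _ d lam', of g c "finite_part \<kappa>"] 4 \<kappa>' that
        by (auto simp: k'_def aux_trans_def)
    qed
    have "(?L has_sum T) (GT_ext N)"
      by (rule has_sum_GT_ext[OF k T(1)]; unfold L) (use True in simp_all)
    moreover have "(?R has_sum T) (GT_ext (N - 1))"
      by (rule has_sum_GT_ext[OF k' T(2)]; unfold R) (use True in simp_all)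
    ultimately show ?thesis by blast
  qed
  then obtain T where T: "(?L has_sum T) (GT_ext N)" "(?R has_sum T) (GT_ext (N - 1))"
    by blast
  show ?thesis
    unfolding infsumI[OF T(1)] infsumI[OF T(2)] using has_sum_imp_summable[OF T(1)] has_sum_imp_summable[OF T(2)] by simp
qed

end
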